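(* Fix $\alpha,\beta>0$, and let $I_q$ and $I_a$ be the quenched and averaged large deviation rate functions of the random walk in the i.i.d. Beta$(\alpha,\beta)$ environment, viewed as functions of $\xi_1\in[0,1]$ (with $\xi=(\xi_1,1-\xi_1)$), as defined in the context. Then $I_q$ is (real-)analytic on $(0,\xi_1^* )$ and on $(\xi_1^*,1)$, is at least four times continuously differentiable at $\xi_1^*$, and as $\xi_1\to\xi_1^*$, $$I_q(\xi)=\frac{(\alpha+\beta)^2}{2\alpha\beta}(\xi_1-\xi_1^* )^2+\frac{(\alpha+\beta)^3(\alpha-\beta)}{6\alpha^2\beta^2}(\xi_1-\xi_1^* )^3+\frac{(\alpha+\beta)^4(2\alpha^2-2\alpha\beta+2\beta^2+1)}{24\alpha^3\beta^3}(\xi_1-\xi_1^* )^4+o(|\xi_1-\xi_1^*|^4),$$ whereas $$I_a(\xi)=\frac{(\alpha+\beta)^2}{2\alpha\beta}(\xi_1-\xi_1^* )^2+\frac{(\alpha+\beta)^3(\alpha-\beta)}{6\alpha^2\beta^2}(\xi_1-\xi_1^* )^3+\frac{(\alpha+\beta)^3(\alpha^3+\beta^3)}{12\alpha^3\beta^3}(\xi_1-\xi_1^* )^4+O(|\xi_1-\xi_1^*|^5).$$ In particular the expansions agree to third order, while $$\frac{d^4}{d\xi_1^4}\Big[I_q(\xi_1,1-\xi_1)-I_a(\xi_1,1-\xi_1)\Big]_{\xi=\xi^*}=\frac{(\alpha+\beta)^4}{\alpha^3\beta^3}>0.$$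
   Context: Let $e_1=(1,0)$, $e_2=(0,1)$. Fix $\alpha,\beta>0$. Under $\mathbb P$, $\omega_{x,x+e_1}$, $x\in\mathbb Z^2$, are i.i.d. Beta$(\alpha,\beta)$, and $\omega_{x,x+e_2}=1-\omega_{x,x+e_1}$. $P^\omega_x$ is the law of the Markov chain $(X_n)_{n\ge0}$ on $\mathbb Z^2$ with $X_0=x$ and $P^\omega_x(X_{n+1}=y+e_i\mid X_n=y)=\omega_{y,y+e_i}$. Let $\mathcal U=\{te_1+(1-t)e_2:0\le t\le1\}$ and $\xi^*=(\xi^*_1,\xi^*_2)=(\frac{\alpha}{\alpha+\beta},\frac{\beta}{\alpha+\beta})$. For $\xi\in\mathcal U$, $[N\xi]$ is a point of $\{(x_1,x_2)\in\mathbb Z^2:x_1+x_2=N\}$ closest to $N\xi$. Quenched rate function: $I_q(\xi)=-\lim_{N\to\infty}N^{-1}\log P_0^\omega\{X_N=[N\xi]\}$, $\xi\in\mathcal U$ (the limit exists $\mathbb P$-a.s. and is deterministic). Averaged rate function: $I_a(\xi)=\xi_1\log\frac{\xi_1}{\xi_1^*}+\xi_2\log\frac{\xi_2}{\xi_2^*}$. The paper's explicit formula for $I_q$: with $\psi_0=\Gamma'/\Gamma$ and $\psi_1=\psi_0'$, $I_q(\xi^* )=0$; for $\xi_1\in(\xi_1^*,1)$, $I_q(\xi)=\xi_1\psi_0(\alpha+\beta+\lambda)+\xi_2\psi_0(\lambda)-\psi_0(\alpha+\lambda)$, where $\lambda=\lambda(\xi)\in(0,\infty)$ is the unique solution of $\xi_1=\frac{\psi_1(\lambda)-\psi_1(\alpha+\lambda)}{\psi_1(\lambda)-\psi_1(\alpha+\beta+\lambda)}$;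 for $\xi_1\in(0,\xi_1^* )$, $I_q(\xi)=\xi_2\psi_0(\alpha+\beta+\lambda)+\xi_1\psi_0(\lambda)-\psi_0(\beta+\lambda)$, where $\lambda=\lambda(\xi)\in(0,\infty)$ is the unique solution of $\xi_2=\frac{\psi_1(\lambda)-\psi_1(\beta+\lambda)}{\psi_1(\lambda)-\psi_1(\alpha+\beta+\lambda)}$. *)

theory Defs
  imports "HOL-Probability.Probability" "HOL-Library.Landau_Symbols"
begin

definition beta_density :: "real \<Rightarrow> real \<Rightarrow> real \<Rightarrow> real" where
  "beta_density \<alpha> \<beta> p =
     (if 0 < p \<and> p < 1 then p powr (\<alpha> - 1) * (1 - p) powr (\<beta> - 1) / Beta \<alpha> \<beta> else 0)"

text \<open>
  The random variable \<open>\<omega> x\<close> is the weight of the edge from \<open>x\<close> to \<open>x + (1, 0)\<close>; the weight of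
  the edge from \<open>x\<close> to \<open>x + (0, 1)\<close> is \<open>1 - \<omega> x\<close>.
\<close>
definition beta_environment ::
  "'s measure \<Rightarrow> real \<Rightarrow> real \<Rightarrow> (int \<times> int \<Rightarrow> 's \<Rightarrow> real) \<Rightarrow> bool" where
  "beta_environment M \<alpha> \<beta> \<omega> \<longleftrightarrow>
     prob_space M \<and>
     prob_space.indep_vars M (\<lambda>_. borel) \<omega> UNIV \<and>
     (\<forall>x. distributed M lborel (\<omega> x) (\<lambda>p. ennreal (beta_density \<alpha> \<beta> p)))"

definition walk_step :: "(int \<times> int \<Rightarrow> real) \<Rightarrow> int \<times> int \<Rightarrow> (int \<times> int) pmf" where
  "walk_step w y = map_pmf (\<lambda>b. if b then y + (1, 0) else y + (0, 1)) (bernoulli_pmf (w y))"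

text \<open>The law of \<open>X\<^sub>n\<close> under the quenched chain started at \<open>x\<close>, in the frozen environment \<open>w\<close>.\<close>
primrec walk_pmf :: "(int \<times> int \<Rightarrow> real) \<Rightarrow> int \<times> int \<Rightarrow> nat \<Rightarrow> (int \<times> int) pmf" where
  "walk_pmf w x 0 = return_pmf x"
| "walk_pmf w x (Suc n) = bind_pmf (walk_pmf w x n) (walk_step w)"

text \<open>Throughout, a direction \<open>\<xi> = (t, 1 - t)\<close> is represented by its first coordinate \<open>t\<close>.\<close>

definition closest_lattice_point :: "nat \<Rightarrow> real \<Rightarrow> int \<times> int \<Rightarrow> bool" where
  "closest_lattice_point N t z \<longleftrightarrow>
     is_arg_min (\<lambda>(i, j). dist (real_of_int i, real_of_int j) (real N * t, real N * (1 - t)))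
       (\<lambda>(i, j). i + j = int N) z"

text \<open>
  \<open>I\<close> is the quenched rate function on \<open>[0, 1]\<close>: in each direction the almost sure limit exists
  and is the deterministic number \<open>I t\<close>. The map \<open>br\<close> is the choice of the lattice points
  \<open>[N \<xi>]\<close>. Values of \<open>I\<close> outside \<open>[0, 1]\<close> are irrelevant.
\<close>
definition quenched_rate_function ::
  "'s measure \<Rightarrow> (int \<times> int \<Rightarrow> 's \<Rightarrow> real) \<Rightarrow> (nat \<Rightarrow> real \<Rightarrow> int \<times> int) \<Rightarrow> (real \<Rightarrow> real) \<Rightarrow> bool"
  where
  "quenched_rate_function M \<omega> br I \<longleftrightarrow>
     (\<forall>t\<in>{0..1}. AE s in M.
        (\<lambda>N. - (ln (pmf (walk_pmf (\<lambda>x. \<omega> x s) (0, 0) N) (br N t)) / real N)) \<longlonglongrightarrow> I t)"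

definition averaged_rate :: "real \<Rightarrow> real \<Rightarrow> real \<Rightarrow> real" where
  "averaged_rate \<alpha> \<beta> t =
     t * ln (t / (\<alpha> / (\<alpha> + \<beta>))) + (1 - t) * ln ((1 - t) / (\<beta> / (\<alpha> + \<beta>)))"

text \<open>
  For \<open>\<alpha>/(\<alpha> + \<beta>) < t < 1\<close>, the unique positive root of the equation parametrizing the direction.
\<close>
definition rate_param :: "real \<Rightarrow> real \<Rightarrow> real \<Rightarrow> real" where
  "rate_param \<alpha> \<beta> t =
     (THE l. 0 < l \<and>
        t = (Polygamma 1 l - Polygamma 1 (\<alpha> + l)) / (Polygamma 1 l - Polygamma 1 (\<alpha> + \<beta> + l)))"

text \<open>
  The closed form of the quenched rate on \<open>(0, 1)\<close>. The parameter in the last branch solves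
  \<open>1 - t = (\<psi>\<^sub>1(l) - \<psi>\<^sub>1(\<beta> + l)) / (\<psi>\<^sub>1(l) - \<psi>\<^sub>1(\<alpha> + \<beta> + l))\<close>, which is the equation of
  \<open>rate_param\<close> with \<open>\<alpha>\<close> and \<open>\<beta>\<close> exchanged.
\<close>
definition quenched_rate_formula :: "real \<Rightarrow> real \<Rightarrow> real \<Rightarrow> real" where
  "quenched_rate_formula \<alpha> \<beta> t =
     (if t = \<alpha> / (\<alpha> + \<beta>) then 0
      else if \<alpha> / (\<alpha> + \<beta>) < t then
        (let l = rate_param \<alpha> \<beta> t
         in t * Digamma (\<alpha> + \<beta> + l) + (1 - t) * Digamma l - Digamma (\<alpha> + l))
      else
        (let l = rate_param \<beta> \<alpha> (1 - t)
         in (1 - t) * Digamma (\<alpha> + \<beta> + l) + t * Digamma l - Digamma (\<beta> + l)))"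

definition real_analytic_on :: "(real \<Rightarrow> real) \<Rightarrow> real set \<Rightarrow> bool" where
  "real_analytic_on f S \<longleftrightarrow>
     (\<forall>x\<in>S. \<exists>r>0. \<exists>a :: nat \<Rightarrow> real. \<forall>y\<in>ball x r. (\<lambda>n. a n * (y - x) ^ n) sums f y)"

text \<open>\<open>f\<close> is \<open>k\<close> times differentiable near \<open>x\<close>, and its \<open>k\<close>-th derivative is continuous there.\<close>
definition times_cont_differentiable_at :: "nat \<Rightarrow> (real \<Rightarrow> real) \<Rightarrow> real \<Rightarrow> bool" where
  "times_cont_differentiable_at k f x \<longleftrightarrow>
     (\<exists>e>0. (\<forall>i<k. \<forall>y\<in>ball x e. (deriv ^^ i) f field_differentiable (at y)) \<and>
            continuous_on (ball x e) ((deriv ^^ k) f))"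

end

(*
  The derivative in t of the closed form vanishes in the parameter l, so that I_q'(t) =
  psi_0(\<alpha> + \<beta> + l) - psi_0(l).  Put u = 1/l and g_s(u) = (psi_1(1/u) - psi_1(s + 1/u)) / u^2.
  Then t = g_\<alpha>(u) / g_(\<alpha>+\<beta>)(u) and dI_q'/du = g_(\<alpha>+\<beta>)(u), so all higher derivatives of I_q
  are rational expressions in the derivatives of g_\<alpha> and g_(\<alpha>+\<beta>).  The minimum of I_q
  corresponds to u -> 0+, where the limits of the derivatives of g_s come from the asymptotic
  expansion of the polygamma functions; the latter follows from the recurrence
  psi_j(x + 1) - psi_j(x) = (-1)^j j! / x^(j+1) by telescoping.  The left branch of I_q is the
  right branch with \<alpha> and \<beta> exchanged, reflected at t = 1/2; both have the same one-sided
  derivatives at the minimum up to order 4, hence can be glued.  The direction t is strictly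
  monotone in l since psi_3/psi_2 is strictly increasing (Cauchy-Schwarz: psi_3^2 < psi_2 psi_4).
*)
theory Submission
  imports Defs "HOL-Complex_Analysis.Complex_Analysis" "HOL-Real_Asymp.Real_Asymp"
begin

subsection \<open>Functions differentiable several times at a point\<close>

text \<open>The factor 1/u^2 in g_s comes from the chain rule for l = 1/u, and it also gives g_s the
  finite nonzero limit s at 0+. For general s the expansion of g_s at u = 0 is only asymptotic, so
  the minimum is reached through one-sided limits of g_s and of its first three derivatives instead
  of a power series.

  This fixes the precision. The third derivative of g_s divides the difference of psi_j by u^(j+4),
  so that difference must be known up to o(u^(j+4)). Three terms of the asymptotic expansion leave
  an error O(x^-(j+4)) in psi_j, because the term of order x^-(j+3) vanishes with the third
  Bernoulli number. The one power still missing is gained by the mean value theorem, which trades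
  the difference of two remainders for one remainder of the next polygamma function.\<close>

lemma DERIV_limit_of_derivative:
  fixes f g :: "real \<Rightarrow> real"
  assumes cont: "isCont f c" and lim: "isCont g c"
    and der: "\<forall>\<^sub>F x in at c. (f has_real_derivative g x) (at x)"
  shows "(f has_real_derivative g c) (at c)"
proof -
  \<comment> \<open>The difference quotient has the form 0/0 at c, and the quotient of derivatives
    in l'Hopital's rule is \<open>g\<close> itself. Only derivatives off c enter, as is the case
    where two branches meet.\<close>
  have "((\<lambda>x. (f x - f c) / (x - c)) \<longlongrightarrow> g c) (at c)"
  proof (rule lhopital)
    show "((\<lambda>x. f x - f c) \<longlongrightarrow> 0) (at c)"
      using cont by (simp add: isCont_def LIM_zero)
    show "((\<lambda>x. x - c) \<longlongrightarrow> 0) (at c)"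
      by (auto intro!: tendsto_eq_intros)
    show "\<forall>\<^sub>F x in at c. x - c \<noteq> 0"
      by (auto simp: eventually_at_filter)
    show "\<forall>\<^sub>F x in at c. (1::real) \<noteq> 0"
      by simp
    show "\<forall>\<^sub>F x in at c. ((\<lambda>x. f x - f c) has_real_derivative g x) (at x)"
      using der by eventually_elim (auto intro!: derivative_eq_intros)
    show "\<forall>\<^sub>F x in at c. ((\<lambda>x. x - c) has_real_derivative 1) (at x)"
      by (auto intro!: always_eventually derivative_eq_intros)
    show "((\<lambda>x. g x / 1) \<longlongrightarrow> g c) (at c)"
      using lim by (simp add: isCont_def)
  qed
  thus ?thesis
    by (simp add: has_field_derivative_iff)
qed

text \<open>Derivatives are handled throughout as explicit chains \<open>H 0\<close>,
  \<open>H 1\<close>, ..., and this links them to iterated \<open>deriv\<close>. The induction runs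
  over all points of the open set at once, since the next \<open>deriv\<close> sees a
  neighbourhood.\<close>

lemma higher_deriv_of_chain:
  fixes H :: "nat \<Rightarrow> real \<Rightarrow> real"
  assumes "open S" and "\<And>x. x \<in> S \<Longrightarrow> f x = H 0 x"
    and "\<And>k x. k < n \<Longrightarrow> x \<in> S \<Longrightarrow> (H k has_real_derivative H (Suc k) x) (at x)"
    and "k \<le> n" and "x \<in> S"
  shows "(deriv ^^ k) f x = H k x"
  using assms(4,5)
proof (induction k arbitrary: x)
  case (Suc k)
  have "deriv ((deriv ^^ k) f) x = deriv (H k) x"
    using Suc \<open>open S\<close> by (intro deriv_cong_ev) (auto simp: eventually_nhds)
  also have "\<dots> = H (Suc k) x"
    using Suc by (intro DERIV_imp_deriv assms(3)) auto
  finally show ?case by simp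
qed (use assms in auto)

lemma times_cont_differentiable_at_of_chain:
  fixes H :: "nat \<Rightarrow> real \<Rightarrow> real"
  assumes "e > 0" and f: "\<And>x. x \<in> ball c e \<Longrightarrow> f x = H 0 x"
    and H: "\<And>k x. k < n \<Longrightarrow> x \<in> ball c e \<Longrightarrow> (H k has_real_derivative H (Suc k) x) (at x)"
    and "continuous_on (ball c e) (H n)"
  shows "times_cont_differentiable_at n f c"
  unfolding times_cont_differentiable_at_def
proof (intro exI[of _ e] conjI allI impI ballI)
  note eq = higher_deriv_of_chain[where S = "ball c e" and f = f and H = H and n = n, OF open_ball f H]
  show "continuous_on (ball c e) ((deriv ^^ n) f)"
    using eq[of n] assms(4) by (subst continuous_on_cong[OF refl]) auto
  fix k x assume kx: "k < n" "x \<in> ball c e"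
  have "((deriv ^^ k) f has_real_derivative H (Suc k) x) (at x)"
    using H[OF kx] by (rule has_field_derivative_transform_within_open[OF _ open_ball])
      (use kx eq[of k] in auto)
  thus "(deriv ^^ k) f field_differentiable at x"
    by (auto simp: field_differentiable_def)
qed (fact \<open>e > 0\<close>)

text \<open>The Lagrange remainder contains \<open>H n\<close> at an intermediate point that tends
  to c with x, and continuity at c replaces it by \<open>H n c\<close>. An expansion of order n thus
  uses n derivatives, which matches the four established for the quenched rate at the
  minimum.\<close>

lemma Taylor_peano:
  fixes H :: "nat \<Rightarrow> real \<Rightarrow> real"
  assumes "e > 0" and "n > 0" and f: "\<And>x. x \<in> ball c e \<Longrightarrow> f x = H 0 x"
    and H: "\<And>k x. k < n \<Longrightarrow> x \<in> ball c e \<Longrightarrow> (H k has_real_derivative H (Suc k) x) (at x)"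
    and cont: "isCont (H n) c"
  shows "(\<lambda>x. f x - (\<Sum>m\<le>n. H m c / fact m * (x - c) ^ m)) \<in> o[at c](\<lambda>x. \<bar>x - c\<bar> ^ n)"
proof (rule landau_o.smallI)
  fix r :: real assume "r > 0"
  from cont have "\<forall>\<^sub>F y in nhds c. \<bar>H n y - H n c\<bar> < r"
    using \<open>r > 0\<close> unfolding isCont_def tendsto_at_iff_tendsto_nhds
    by (auto simp: tendsto_iff dist_real_def)
  then obtain d where d: "d > 0" "\<And>y. dist y c < d \<Longrightarrow> \<bar>H n y - H n c\<bar> < r"
    by (auto simp: eventually_nhds_metric)
  have "norm (f x - (\<Sum>m\<le>n. H m c / fact m * (x - c) ^ m)) \<le> r * norm (\<bar>x - c\<bar> ^ n)"
    if x: "x \<noteq> c" "dist x c < min d (e / 2)" for x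
  proof -
    have "\<exists>t. (if x < c then x < t \<and> t < c else c < t \<and> t < x) \<and>
        H 0 x = (\<Sum>m<n. (H m c / fact m) * (x - c)^m) + (H n t / fact n) * (x - c)^n"
    \<comment> \<open>\<open>Taylor\<close> works on a closed interval, so the radius is halved to
      stay inside the open ball.\<close>
    proof (rule Taylor[of n H "H 0" "c - e / 2" "c + e / 2"])
      show "\<forall>m t. m < n \<and> c - e / 2 \<le> t \<and> t \<le> c + e / 2 \<longrightarrow>
          (H m has_real_derivative H (Suc m) t) (at t)"
        using \<open>e > 0\<close> by (auto intro!: H simp: dist_real_def)
    qed (use x \<open>e > 0\<close> \<open>n > 0\<close> in \<open>auto simp: dist_real_def abs_if field_simps split: if_splits\<close>)
    then obtain t where t: "if x < c then x < t \<and> t < c else c < t \<and> t < x"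
      and eq: "H 0 x = (\<Sum>m<n. (H m c / fact m) * (x - c)^m) + (H n t / fact n) * (x - c)^n"
      by blast
    have "{..n} = insert n {..<n}" by auto
    hence "f x - (\<Sum>m\<le>n. H m c / fact m * (x - c) ^ m) = (H n t - H n c) / fact n * (x - c) ^ n"
      using eq f[of x] x \<open>e > 0\<close> by (simp add: dist_real_def abs_minus_commute field_simps)
    hence "norm (f x - (\<Sum>m\<le>n. H m c / fact m * (x - c) ^ m)) =
        \<bar>H n t - H n c\<bar> / fact n * \<bar>x - c\<bar> ^ n"
      by (simp add: abs_mult power_abs)
    also have "\<bar>H n t - H n c\<bar> / fact n \<le> r / 1"
    proof (rule frac_le)
      show "\<bar>H n t - H n c\<bar> \<le> r"
        using d(2)[of t] t x by (auto simp: dist_real_def split: if_splits)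
    qed (use \<open>r > 0\<close> in \<open>auto simp: fact_ge_1\<close>)
    finally show ?thesis by (simp add: mult_right_mono)
  qed
  moreover have "min d (e / 2) > 0"
    using d \<open>e > 0\<close> by simp
  ultimately show "\<forall>\<^sub>F x in at c. norm (f x - (\<Sum>m\<le>n. H m c / fact m * (x - c) ^ m)) \<le>
      r * norm (\<bar>x - c\<bar> ^ n)"
    unfolding eventually_at by blast
qed

subsection \<open>Asymptotics of the polygamma functions\<close>

text \<open>As \<open>r\<close> vanishes along x, x + 1, x + 2, ..., its value at x is the sum of
  its unit differences from x on. Their bounds telescope to at most a constant times
  \<open>h x\<close>, because \<open>h\<close> is nonnegative.\<close>

lemma bigo_telescope:
  fixes r h :: "real \<Rightarrow> real"
  assumes diff: "(\<lambda>x. r x - r (x + 1)) \<in> O(\<lambda>x. h x - h (x + 1))"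
    and lim: "\<And>x. x > 0 \<Longrightarrow> (\<lambda>n. r (x + real n)) \<longlonglongrightarrow> 0"
    and h: "\<And>x. x > 0 \<Longrightarrow> h x \<ge> 0" "\<And>x. x > 0 \<Longrightarrow> h (x + 1) \<le> h x"
  shows "r \<in> O(h)"
proof -
  obtain C where C: "C > 0" "\<forall>\<^sub>F x in at_top. norm (r x - r (x + 1)) \<le> C * norm (h x - h (x + 1))"
    using landau_o.bigE[OF diff] by blast
  then obtain x0 where x0: "\<And>x. x \<ge> x0 \<Longrightarrow> norm (r x - r (x + 1)) \<le> C * norm (h x - h (x + 1))"
    by (auto simp: eventually_at_top_linorder)
  have "norm (r x) \<le> C * norm (h x)" if x: "x \<ge> max x0 1" for x
  proof -
    have step: "\<bar>r x\<bar> \<le> \<bar>r (x + real n)\<bar> + C * (h x - h (x + real n))" for n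
    proof (induction n)
      case (Suc n)
      have "\<bar>r (x + real n) - r (x + real n + 1)\<bar> \<le> C * (h (x + real n) - h (x + real n + 1))"
        using x0[of "x + real n"] h(2)[of "x + real n"] x by simp
      with Suc show ?case by (simp add: algebra_simps)
    qed simp
    have "\<bar>r x\<bar> \<le> \<bar>r (x + real n)\<bar> + C * h x" for n
    proof -
      have "0 \<le> C * h (x + real n)" using h(1)[of "x + real n"] C(1) x by auto
      thus ?thesis using step[of n] by (simp add: algebra_simps)
    qed
    moreover have "(\<lambda>n. \<bar>r (x + real n)\<bar> + C * h x) \<longlonglongrightarrow> \<bar>0\<bar> + C * h x"
      using x by (intro tendsto_intros lim) auto
    ultimately have "\<bar>r x\<bar> \<le> \<bar>0\<bar> + C * h x"
      by (intro LIMSEQ_le_const) auto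
    thus ?thesis using h(1)[of x] x by simp
  qed
  thus ?thesis
    by (intro landau_o.bigI[OF C(1)] eventually_at_top_linorderI[of "max x0 1"])
qed

text \<open>Up to sign and factorial, \<open>Polygamma j x\<close> is the series of 1/(x + k)^(j+1),
  and shifting the argument by n deletes its first n terms. What remains is a tail of a convergent
  series.\<close>

lemma Polygamma_plus_of_nat_tendsto_0:
  fixes x :: real
  assumes "x > 0" and "j > 0"
  shows "(\<lambda>n. Polygamma j (x + real n)) \<longlonglongrightarrow> 0"
proof -
  have nz: "x \<noteq> - real k" for k
    using assms by linarith
  have x: "x \<notin> \<int>\<^sub>\<le>\<^sub>0"
    using assms by auto
  have "(\<lambda>k. inverse ((x + of_nat k) ^ Suc j)) sums ((- 1) ^ Suc j * Polygamma j x / fact j)"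
    using x assms by (intro Polygamma_LIMSEQ) auto
  hence "(\<lambda>n. Polygamma j x + (-1) ^ j * fact j * (\<Sum>k<n. inverse ((x + of_nat k) ^ Suc j)))
      \<longlonglongrightarrow> Polygamma j x + (-1) ^ j * fact j * ((- 1) ^ Suc j * Polygamma j x / fact j)"
    unfolding sums_def by (intro tendsto_intros)
  also have "Polygamma j x + (-1) ^ j * fact j * ((- 1) ^ Suc j * Polygamma j x / fact j) = 0"
    by (cases "even j") auto
  also have "(\<lambda>n. Polygamma j x + (-1) ^ j * fact j * (\<Sum>k<n. inverse ((x + of_nat k) ^ Suc j))) =
      (\<lambda>n. Polygamma j (x + real n))"
    using nz by (subst Polygamma_plus_of_nat) (auto simp: inverse_eq_divide)
  finally show ?thesis .
qed

text \<open>The first three terms of the asymptotic expansion of \<open>Polygamma j\<close> at infinity.\<close>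
definition stirling_part :: "nat \<Rightarrow> real \<Rightarrow> real" where
  "stirling_part j x =
     (-1) ^ Suc j * (fact (j - 1) / x ^ j + fact j / (2 * x ^ Suc j) + fact (Suc j) / (12 * x ^ (j + 2)))"

text \<open>The three terms for j pass exactly into those for j + 1. Hence the remainder of
  \<open>Polygamma (Suc j)\<close> is the derivative of the remainder of
  \<open>Polygamma j\<close>.\<close>

lemma stirling_part_DERIV:
  assumes "x > 0" "j > 0"
  shows "(stirling_part j has_real_derivative stirling_part (Suc j) x) (at x)"
proof -
  have pow: "((\<lambda>x. c / x ^ k) has_real_derivative - (real k * c / x ^ Suc k)) (at x)" for c :: real and k
    using assms by (cases k) (auto intro!: derivative_eq_intros simp del: power_Suc, simp add: field_simps)
  have "stirling_part j = (\<lambda>x. (-1) ^ Suc j *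
      (fact (j - 1) / x ^ j + fact j / 2 / x ^ Suc j + fact (Suc j) / 12 / x ^ (j + 2)))"
    by (simp add: stirling_part_def fun_eq_iff)
  moreover have "(\<dots> has_real_derivative (-1) ^ Suc j *
      (- (real j * fact (j - 1) / x ^ Suc j) + - (real (Suc j) * (fact j / 2) / x ^ Suc (Suc j)) +
       - (real (j + 2) * (fact (Suc j) / 12) / x ^ Suc (j + 2)))) (at x)"
    by (intro DERIV_cmult DERIV_add pow)
  moreover have "real j * fact (j - 1) = fact j"
    using assms by (simp add: fact_reduce)
  moreover have "real (Suc j) * (fact j / 2) = fact (Suc j) / 2"
    by simp
  moreover have "real (j + 2) * (fact (Suc j) / 12) = fact (Suc (Suc j)) / 12"
    by (simp add: fact_reduce)
  moreover have "(-1) ^ Suc j * (- (fact j / x ^ Suc j) + - (fact (Suc j) / 2 / x ^ Suc (Suc j)) +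
      - (fact (Suc (Suc j)) / 12 / x ^ Suc (j + 2))) = stirling_part (Suc j) x"
    by (simp add: stirling_part_def del: fact_Suc) (simp add: algebra_simps del: fact_Suc)
  ultimately show ?thesis
    by (simp only:)
qed

text \<open>The range of j is what \<open>polygamma_gap_remainder\<close> uses: a gap of order 1 to
  4 is controlled by the remainder one order higher. Being finite, it can be enumerated, so that
  \<open>real_asymp\<close> meets concrete exponents.\<close>

lemma Polygamma_asymp:
  assumes "j \<in> {2..5}"
  shows "(\<lambda>x::real. Polygamma j x - stirling_part j x) \<in> O(\<lambda>x. 1 / x ^ (j + 4))"
proof (rule bigo_telescope)
  have "\<forall>\<^sub>F x::real in at_top. (Polygamma j x - stirling_part j x) -
      (Polygamma j (x + 1) - stirling_part j (x + 1)) =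
      stirling_part j (x + 1) - stirling_part j x - (-1) ^ j * fact j / x ^ Suc j"
    using eventually_gt_at_top[of 0] by eventually_elim (auto simp: Polygamma_plus1)
  \<comment> \<open>The three terms satisfy the recurrence up to order x^-(j+5), which is the order
    of a unit difference of x^-(j+4).\<close>
  moreover have "(\<lambda>x. stirling_part j (x + 1) - stirling_part j x - (-1) ^ j * fact j / x ^ Suc j)
      \<in> O(\<lambda>x. 1 / x ^ (j + 4) - 1 / (x + 1) ^ (j + 4))"
  proof -
    have "j = 2 \<or> j = 3 \<or> j = 4 \<or> j = 5" using assms by auto
    thus ?thesis
      unfolding stirling_part_def
      by (elim disjE; simp add: fact_numeral eval_nat_numeral; real_asymp)
  qed
  ultimately show "(\<lambda>x::real. (Polygamma j x - stirling_part j x) -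
      (Polygamma j (x + 1) - stirling_part j (x + 1)))
      \<in> O(\<lambda>x. 1 / x ^ (j + 4) - 1 / (x + 1) ^ (j + 4))"
    by (subst landau_o.big.in_cong) auto
  show "(\<lambda>n. Polygamma j (x + real n) - stirling_part j (x + real n)) \<longlonglongrightarrow> 0" if "x > 0" for x
  proof -
    have "j = 2 \<or> j = 3 \<or> j = 4 \<or> j = 5" using assms by auto
    hence "(stirling_part j \<longlongrightarrow> 0) at_top"
      unfolding stirling_part_def[abs_def]
      by (elim disjE; simp add: fact_numeral eval_nat_numeral; real_asymp)
    moreover have "filterlim (\<lambda>n. x + real n) at_top sequentially"
      by real_asymp
    ultimately have "(\<lambda>n. stirling_part j (x + real n)) \<longlonglongrightarrow> 0"
      by (rule filterlim_compose)
    from tendsto_diff[OF Polygamma_plus_of_nat_tendsto_0[OF that] this]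
    show ?thesis using assms by simp
  qed
qed (auto intro!: divide_left_mono power_mono)

section \<open>Differences of polygamma functions in the variable u = 1/l\<close>

definition polygamma_gap :: "real \<Rightarrow> nat \<Rightarrow> real \<Rightarrow> real" where
  "polygamma_gap s j u = Polygamma j (1 / u) - Polygamma j (s + 1 / u)"

text \<open>
  The derivatives, for \<open>k \<le> 3\<close>, of \<open>(\<psi>\<^sub>1(1/u) - \<psi>\<^sub>1(s + 1/u)) / u\<^sup>2\<close> with respect to \<open>u\<close>,
  followed by their limits at \<open>0\<close>.
\<close>
definition trigamma_gap :: "real \<Rightarrow> nat \<Rightarrow> real \<Rightarrow> real" where
  "trigamma_gap s k u = (let P = (\<lambda>j. polygamma_gap s j u) in
     [P 1 / u^2,
      - (2 * P 1 / u^3 + P 2 / u^4),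
      6 * P 1 / u^4 + 6 * P 2 / u^5 + P 3 / u^6,
      - (24 * P 1 / u^5 + 36 * P 2 / u^6 + 12 * P 3 / u^7 + P 4 / u^8)] ! k)"

definition trigamma_gap_limit :: "real \<Rightarrow> nat \<Rightarrow> real" where
  "trigamma_gap_limit s k =
     [s, s * (1 - s), s * (1 - s) * (1 - 2 * s), - (6 * s^2 * (1 - s)^2)] ! k"

lemma polygamma_gap_DERIV:
  assumes "u > 0" "s \<ge> 0"
  shows "(polygamma_gap s j has_real_derivative - (polygamma_gap s (Suc j) u / u^2)) (at u)"
proof -
  have "s + 1 / u > 0" "1 / u > 0"
    using assms by (auto intro: add_nonneg_pos)
  hence "s + 1 / u \<notin> \<int>\<^sub>\<le>\<^sub>0" "1 / u \<notin> \<int>\<^sub>\<le>\<^sub>0"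
    by (auto dest: nonpos_Ints_nonpos)
  thus ?thesis
    unfolding polygamma_gap_def[abs_def] using assms
    by (auto intro!: derivative_eq_intros simp: field_simps power2_eq_square)
qed

lemma trigamma_gap_DERIV:
  assumes "u > 0" "s \<ge> 0" "k < 3"
  shows "(trigamma_gap s k has_real_derivative trigamma_gap s (Suc k) u) (at u)"
proof -
  note [derivative_intros] = polygamma_gap_DERIV[THEN DERIV_chain2]
  have "k = 0 \<or> k = 1 \<or> k = 2" using assms by auto
  thus ?thesis
  proof (elim disjE)
    assume k: "k = 0"
    show ?thesis
      unfolding k trigamma_gap_def[abs_def] Let_def using assms(1,2)
      by (auto intro!: derivative_eq_intros simp: numeral_2_eq_2[symmetric] divide_simps)
        (simp add: algebra_simps eval_nat_numeral)
  next
    assume k: "k = 1"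
    show ?thesis
      unfolding k trigamma_gap_def[abs_def] Let_def using assms(1,2)
      by (auto intro!: derivative_eq_intros)
        (simp add: divide_simps, simp add: algebra_simps eval_nat_numeral)
  next
    assume k: "k = 2"
    show ?thesis
      unfolding k trigamma_gap_def[abs_def] Let_def using assms(1,2)
      by (auto intro!: derivative_eq_intros)
        (simp add: divide_simps, simp add: algebra_simps eval_nat_numeral)
  qed
qed

text \<open>Bounding the remainders at 1/u and s + 1/u separately would give only O(u^(j+4)). By the
  mean value theorem their difference is s times the remainder of order j + 1 at a point beyond 1/u,
  hence O(u^(j+5)).\<close>

lemma polygamma_gap_remainder:
  assumes "s > 0" and j: "j \<in> {1..4}"
  shows "((\<lambda>u. (polygamma_gap s j u - (stirling_part j (1 / u) - stirling_part j (s + 1 / u))) / u ^ (j + 4))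
           \<longlongrightarrow> 0) (at_right 0)"
proof -
  define r where "r = (\<lambda>i x::real. Polygamma i x - stirling_part i x)"
  have "r (Suc j) \<in> O(\<lambda>x. 1 / x ^ (j + 5))"
    using Polygamma_asymp[of "Suc j"] j by (simp add: r_def add.commute)
  then obtain C where C: "C > 0" "\<forall>\<^sub>F x in at_top. norm (r (Suc j) x) \<le> C * norm (1 / x ^ (j + 5))"
    using landau_o.bigE by blast
  then obtain x0 where x0: "\<And>x. x \<ge> x0 \<Longrightarrow> norm (r (Suc j) x) \<le> C * norm (1 / x ^ (j + 5))"
    by (auto simp: eventually_at_top_linorder)
  have bound: "\<bar>r j x - r j (s + x)\<bar> \<le> s * C / x ^ (j + 5)" if x: "x \<ge> max x0 1" for x
  proof -
    have "\<exists>z>x. z < s + x \<and> r j (s + x) - r j x = (s + x - x) * r (Suc j) z"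
    proof (rule MVT2)
      fix z assume "x \<le> z"
      hence "z > 0" using x by auto
      moreover from this have "z \<notin> \<int>\<^sub>\<le>\<^sub>0" by (auto dest: nonpos_Ints_nonpos)
      ultimately show "(r j has_real_derivative r (Suc j) z) (at z)"
        unfolding r_def using j
        by (intro DERIV_diff has_field_derivative_Polygamma stirling_part_DERIV) auto
    qed (use \<open>s > 0\<close> in auto)
    then obtain z where z: "z > x" "r j (s + x) - r j x = s * r (Suc j) z"
      by auto
    have "\<bar>r j x - r j (s + x)\<bar> = \<bar>s * r (Suc j) z\<bar>"
      using z(2) by linarith
    also have "\<dots> = s * \<bar>r (Suc j) z\<bar>"
      using \<open>s > 0\<close> by (simp add: abs_mult)
    also have "\<bar>r (Suc j) z\<bar> \<le> C * (1 / z ^ (j + 5))"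
      using x0[of z] z(1) x by auto
    also have "\<dots> \<le> C * (1 / x ^ (j + 5))"
      using z(1) x C(1) by (intro mult_left_mono divide_left_mono power_mono mult_pos_pos) auto
    finally show ?thesis using \<open>s > 0\<close> by simp
  qed
  have eq: "polygamma_gap s j u - (stirling_part j (1 / u) - stirling_part j (s + 1 / u)) =
      r j (1 / u) - r j (s + 1 / u)" for u
    by (simp add: polygamma_gap_def r_def)
  have "filterlim (\<lambda>u::real. 1 / u) at_top (at_right 0)"
    by real_asymp
  hence "\<forall>\<^sub>F u::real in at_right 0. 1 / u \<ge> max x0 1"
    by (simp only: filterlim_at_top)
  moreover have "\<forall>\<^sub>F u::real in at_right 0. u > 0"
    by (simp add: eventually_at_right_less)
  ultimately have "\<forall>\<^sub>F u in at_right 0. norm ((polygamma_gap s j u -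
      (stirling_part j (1 / u) - stirling_part j (s + 1 / u))) / u ^ (j + 4)) \<le> s * C * u"
  proof eventually_elim
    case (elim u)
    have "\<bar>r j (1 / u) - r j (s + 1 / u)\<bar> \<le> s * C * u ^ (j + 5)"
      using bound[OF elim(1)] elim(2) by (simp add: power_one_over)
    thus ?case
      unfolding eq using elim(2) by (simp add: divide_le_eq eval_nat_numeral algebra_simps)
  qed
  moreover have "((\<lambda>u. s * C * u) \<longlongrightarrow> 0) (at_right 0)"
    by (auto intro!: tendsto_eq_intros)
  ultimately show ?thesis
    by (rule Lim_null_comparison)
qed

text \<open>Each gap is its Stirling part \<open>Q j\<close> plus \<open>R j * u ^ (j + 4)\<close>
  with \<open>R j\<close> tending to 0. The Stirling parts contribute an explicit rational function
  of u, whose limit \<open>real_asymp\<close> finds. The remainders survive the division because no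
  gap of order j is divided by more than u^(j+4).\<close>

lemma trigamma_gap_tendsto:
  assumes "s > 0" "k \<le> 3"
  shows "(trigamma_gap s k \<longlongrightarrow> trigamma_gap_limit s k) (at_right 0)"
proof -
  define Q where "Q = (\<lambda>j u. stirling_part j (1 / u) - stirling_part j (s + 1 / u))"
  define R where "R = (\<lambda>j u. (polygamma_gap s j u - Q j u) / u ^ (j + 4))"
  have R: "(R j \<longlongrightarrow> 0) (at_right 0)" if "j \<in> {1..4}" for j
    using polygamma_gap_remainder[OF \<open>s > 0\<close> that] by (simp add: R_def Q_def)
  have Rs: "(R (Suc 0) \<longlongrightarrow> 0) (at_right 0)" "(R 2 \<longlongrightarrow> 0) (at_right 0)"
    "(R 3 \<longlongrightarrow> 0) (at_right 0)" "(R 4 \<longlongrightarrow> 0) (at_right 0)"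
    by (simp_all add: R)
  have P: "polygamma_gap s j u = Q j u + R j u * u ^ (j + 4)" if "u > 0" for j u
    using that by (simp add: R_def)
  note lim = tendsto_add[OF _ _, THEN Lim_transform_eventually]
  have pos: "\<forall>\<^sub>F u::real in at_right 0. u > 0"
    by (simp add: eventually_at_right_less)
  have "k = 0 \<or> k = 1 \<or> k = 2 \<or> k = 3" using assms by auto
  thus ?thesis
  proof (elim disjE)
    assume k: "k = 0"
    have "((\<lambda>u. Q 1 u / u^2) \<longlongrightarrow> s) (at_right 0)"
      unfolding Q_def stirling_part_def using \<open>s > 0\<close> by (simp add: fact_numeral) real_asymp
    moreover have "((\<lambda>u. u^3 * R 1 u) \<longlongrightarrow> 0) (at_right 0)"
      by (auto intro!: tendsto_eq_intros Rs)
    moreover have "\<forall>\<^sub>F u in at_right 0. Q 1 u / u^2 + u^3 * R 1 u = trigamma_gap s k u"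
      using pos by eventually_elim (simp add: k trigamma_gap_def P field_simps eval_nat_numeral)
    ultimately show ?thesis
      using lim by (fastforce simp: k trigamma_gap_limit_def)
  next
    assume k: "k = 1"
    have "((\<lambda>u. - (2 * Q 1 u / u^3 + Q 2 u / u^4)) \<longlongrightarrow> s * (1 - s)) (at_right 0)"
      unfolding Q_def stirling_part_def using \<open>s > 0\<close>
      by (simp add: fact_numeral) (real_asymp simp: algebra_simps power2_eq_square)
    moreover have "((\<lambda>u. - (2 * u^2 * R 1 u + u^2 * R 2 u)) \<longlongrightarrow> 0) (at_right 0)"
      by (auto intro!: tendsto_eq_intros Rs)
    moreover have "\<forall>\<^sub>F u in at_right 0. - (2 * Q 1 u / u^3 + Q 2 u / u^4) +
        - (2 * u^2 * R 1 u + u^2 * R 2 u) = trigamma_gap s k u"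
      using pos by eventually_elim (simp add: k trigamma_gap_def P field_simps eval_nat_numeral)
    ultimately show ?thesis
      using lim by (fastforce simp: k trigamma_gap_limit_def)
  next
    assume k: "k = 2"
    have "((\<lambda>u. 6 * Q 1 u / u^4 + 6 * Q 2 u / u^5 + Q 3 u / u^6)
        \<longlongrightarrow> s * (1 - s) * (1 - 2 * s)) (at_right 0)"
      unfolding Q_def stirling_part_def using \<open>s > 0\<close>
      by (simp add: fact_numeral) (real_asymp simp: algebra_simps power2_eq_square)
    moreover have "((\<lambda>u. 6 * u * R 1 u + 6 * u * R 2 u + u * R 3 u) \<longlongrightarrow> 0) (at_right 0)"
      by (auto intro!: tendsto_eq_intros Rs)
    moreover have "\<forall>\<^sub>F u in at_right 0. 6 * Q 1 u / u^4 + 6 * Q 2 u / u^5 + Q 3 u / u^6 +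
        (6 * u * R 1 u + 6 * u * R 2 u + u * R 3 u) = trigamma_gap s k u"
      using pos by eventually_elim (simp add: k trigamma_gap_def P field_simps eval_nat_numeral)
    ultimately show ?thesis
      using lim by (fastforce simp: k trigamma_gap_limit_def)
  next
    assume k: "k = 3"
    have "((\<lambda>u. - (24 * Q 1 u / u^5 + 36 * Q 2 u / u^6 + 12 * Q 3 u / u^7 + Q 4 u / u^8))
        \<longlongrightarrow> - (6 * s^2 * (1 - s)^2)) (at_right 0)"
      unfolding Q_def stirling_part_def using \<open>s > 0\<close>
      by (simp add: fact_numeral) (real_asymp simp: algebra_simps power2_eq_square)
    \<comment> \<open>At this order the powers of u cancel completely, so only the decay of the
      \<open>R j\<close> is left.\<close>
    moreover have "((\<lambda>u. - (24 * R 1 u + 36 * R 2 u + 12 * R 3 u + R 4 u)) \<longlongrightarrow> 0) (at_right 0)"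
      by (auto intro!: tendsto_eq_intros Rs)
    moreover have "\<forall>\<^sub>F u in at_right 0.
        - (24 * Q 1 u / u^5 + 36 * Q 2 u / u^6 + 12 * Q 3 u / u^7 + Q 4 u / u^8) +
        - (24 * R 1 u + 36 * R 2 u + 12 * R 3 u + R 4 u) = trigamma_gap s k u"
      using pos by eventually_elim (simp add: k trigamma_gap_def P field_simps eval_nat_numeral)
    ultimately show ?thesis
      using lim by (fastforce simp: k trigamma_gap_limit_def)
  qed
qed

subsection \<open>The direction as a function of the parameter\<close>

lemma pos_notin_nonpos_Ints [simp]: "x > 0 \<Longrightarrow> (x::real) \<notin> \<int>\<^sub>\<le>\<^sub>0"
  by (auto dest: nonpos_Ints_nonpos)

text \<open>Cauchy-Schwarz for the series of p^-3, p^-4 and p^-5, obtained by summing the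
  nonnegative terms p^-3 (1 - y/p)^2. The choice y = B/C minimizes the resulting quadratic A - 2 y B
  + y^2 C.\<close>

lemma Polygamma_3_squared_less:
  fixes x :: real
  assumes "x > 0"
  shows "(Polygamma 3 x)^2 < Polygamma 2 x * Polygamma 4 x"
proof -
  define p where "p = (\<lambda>k. x + real k)"
  have p: "p k > 0" for k
    using assms by (simp add: p_def add_pos_nonneg)
  define A B C where "A = - Polygamma 2 x / 2" and "B = Polygamma 3 x / 6" and "C = - Polygamma 4 x / 24"
  have sums: "(\<lambda>k. inverse (p k ^ Suc n)) sums ((- 1) ^ Suc n * Polygamma n x / fact n)" if "n > 0" for n
    unfolding p_def using assms that by (intro Polygamma_LIMSEQ) auto
  have A: "(\<lambda>k. inverse (p k ^ 3)) sums A"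
    using sums[of 2] by (simp add: A_def eval_nat_numeral)
  have B: "(\<lambda>k. inverse (p k ^ 4)) sums B"
    using sums[of 3] by (simp add: B_def eval_nat_numeral)
  have C: "(\<lambda>k. inverse (p k ^ 5)) sums C"
    using sums[of 4] by (simp add: C_def eval_nat_numeral)
  have neg: "Polygamma 2 x < 0" "Polygamma 4 x < 0" and pos: "Polygamma 3 x > 0"
    using assms by (auto intro!: Polygamma_real_even_neg Polygamma_real_odd_pos)
  have "0 \<le> A - 2 * (B / C) * B + (B / C)^2 * C"
  proof (rule sums_le)
    show "(\<lambda>k. 0) sums (0::real)" by simp
    show "(\<lambda>k. inverse (p k ^ 3) - 2 * (B / C) * inverse (p k ^ 4) + (B / C)^2 * inverse (p k ^ 5)) sums
        (A - 2 * (B / C) * B + (B / C)^2 * C)"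
      by (intro sums_add sums_diff sums_mult A B C)
    fix k
    have "inverse (p k ^ 3) - 2 * (B / C) * inverse (p k ^ 4) + (B / C)^2 * inverse (p k ^ 5) =
        inverse (p k ^ 3) * (1 - B / C / p k)^2"
      using p[of k] by (simp add: divide_simps) (simp add: algebra_simps eval_nat_numeral)
    thus "0 \<le> inverse (p k ^ 3) - 2 * (B / C) * inverse (p k ^ 4) + (B / C)^2 * inverse (p k ^ 5)"
      using p[of k] by simp
  qed
  moreover have "C > 0"
    using neg by (simp add: C_def)
  ultimately have "B^2 \<le> A * C"
    by (simp add: field_simps power2_eq_square)
  \<comment> \<open>The factorials give B^2 = psi_3^2 / 36 and A C = psi_2 psi_4 / 48. The factor
    36/48 < 1 supplies strictness.\<close>
  hence "(Polygamma 3 x)^2 \<le> 3 / 4 * (Polygamma 2 x * Polygamma 4 x)"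
    by (simp add: A_def B_def C_def field_simps power2_eq_square)
  also have "\<dots> < Polygamma 2 x * Polygamma 4 x"
    using mult_neg_neg[OF neg] by simp
  finally show ?thesis .
qed

lemma Polygamma_3_2_ratio_strict_mono:
  fixes x y :: real
  assumes "0 < x" "x < y"
  shows "Polygamma 3 x / Polygamma 2 x < Polygamma 3 y / Polygamma 2 y"
proof (rule DERIV_pos_imp_increasing[OF \<open>x < y\<close>])
  fix z assume "x \<le> z"
  hence z: "z > 0" using assms by simp
  have neg: "Polygamma 2 z < 0"
    using z by (auto intro!: Polygamma_real_even_neg)
  have "((\<lambda>z. Polygamma 3 z / Polygamma 2 z) has_real_derivative
      (Polygamma 4 z * Polygamma 2 z - Polygamma 3 z * Polygamma 3 z) / (Polygamma 2 z * Polygamma 2 z)) (at z)"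
    using z neg by (auto intro!: derivative_eq_intros simp: eval_nat_numeral)
  moreover have "(Polygamma 4 z * Polygamma 2 z - Polygamma 3 z * Polygamma 3 z) /
      (Polygamma 2 z * Polygamma 2 z) > 0"
    using Polygamma_3_squared_less[OF z] neg
    by (intro divide_pos_pos mult_neg_neg) (auto simp: power2_eq_square mult.commute)
  ultimately show "\<exists>D. ((\<lambda>z. Polygamma 3 z / Polygamma 2 z) has_real_derivative D) (at z) \<and> D > 0"
    by blast
qed

lemma polygamma_gap_pos:
  assumes "0 < l" "0 < s"
  shows "Polygamma 1 l - Polygamma 1 (s + l) > (0::real)"
  using Polygamma_real_strict_antimono[of l "s + l" 1] assms by simp

text \<open>By Cauchy's mean value theorem the psi_2-gap is q(z1) times the psi_1-gap on [l, a + l],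
  and q(z2) times it on [a + l, a + b + l], where q = psi_3/psi_2 increases and z1 < a + l < z2. The
  quotient over the whole interval is a weighted mean of the two, so it exceeds q(z1).\<close>

lemma polygamma_gap_wronskian:
  fixes a b l :: real
  assumes "a > 0" "b > 0" "l > 0"
  shows "(Polygamma 2 l - Polygamma 2 (a + l)) * (Polygamma 1 l - Polygamma 1 (a + b + l)) <
         (Polygamma 1 l - Polygamma 1 (a + l)) * (Polygamma 2 l - Polygamma 2 (a + b + l))"
proof -
  define q where "q = (\<lambda>x::real. Polygamma 3 x / Polygamma 2 x)"
  have quot: "\<exists>z>x. z < y \<and> Polygamma 2 x - Polygamma 2 y = q z * (Polygamma 1 x - Polygamma 1 y)"
    if "0 < x" "x < y" for x y
  proof -
    have "\<exists>z. x < z \<and> z < y \<and> (Polygamma 2 y - Polygamma 2 x) * Polygamma 2 z =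
        (Polygamma 1 y - Polygamma 1 x) * Polygamma 3 z"
      using that by (intro GMVT' isCont_Polygamma continuous_ident)
        (auto intro!: derivative_eq_intros simp: eval_nat_numeral)
    then obtain z where z: "x < z" "z < y" "(Polygamma 2 y - Polygamma 2 x) * Polygamma 2 z =
        (Polygamma 1 y - Polygamma 1 x) * Polygamma 3 z"
      by blast
    moreover have "Polygamma 2 z < 0"
      using z that by (auto intro!: Polygamma_real_even_neg)
    ultimately show ?thesis
      by (intro exI[of _ z]) (auto simp: q_def field_simps)
  qed
  obtain z1 where z1: "z1 > l" "z1 < a + l"
    "Polygamma 2 l - Polygamma 2 (a + l) = q z1 * (Polygamma 1 l - Polygamma 1 (a + l))"
    using quot[of l "a + l"] assms by auto
  obtain z2 where z2: "z2 > a + l"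
    "Polygamma 2 (a + l) - Polygamma 2 (a + b + l) = q z2 * (Polygamma 1 (a + l) - Polygamma 1 (a + b + l))"
    using quot[of "a + l" "a + b + l"] assms by auto
  define N N2 where "N = Polygamma 1 l - Polygamma 1 (a + l)"
    and "N2 = Polygamma 1 (a + l) - Polygamma 1 (a + b + l)"
  have pos: "N > 0" "N2 > 0"
    using polygamma_gap_pos[of l a] polygamma_gap_pos[of "a + l" b] assms
    by (auto simp: N_def N2_def add_ac)
  have "q z1 < q z2"
    unfolding q_def using z1 z2 assms by (intro Polygamma_3_2_ratio_strict_mono) auto
  hence "q z1 * (N * N2) < q z2 * (N * N2)"
    using pos by simp
  hence "(q z1 * N) * (N + N2) < N * (q z1 * N + q z2 * N2)"
    by (simp add: algebra_simps)
  moreover have "Polygamma 1 l - Polygamma 1 (a + l) = N"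
    "Polygamma 1 l - Polygamma 1 (a + b + l) = N + N2"
    "Polygamma 2 l - Polygamma 2 (a + l) = q z1 * N"
    "Polygamma 2 l - Polygamma 2 (a + b + l) = q z1 * N + q z2 * N2"
    using z1(3) z2(2) by (simp_all add: N_def N2_def)
  ultimately show ?thesis
    by (simp only:)
qed

text \<open>The direction t belonging to the parameter l, that is, the right-hand side of the
  equation in \<open>rate_param\<close>.\<close>

definition trigamma_ratio :: "real \<Rightarrow> real \<Rightarrow> real \<Rightarrow> real" where
  "trigamma_ratio a b l =
     (Polygamma 1 l - Polygamma 1 (a + l)) / (Polygamma 1 l - Polygamma 1 (a + b + l))"

definition trigamma_ratio_deriv :: "real \<Rightarrow> real \<Rightarrow> real \<Rightarrow> real" where
  "trigamma_ratio_deriv a b l =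
     ((Polygamma 2 l - Polygamma 2 (a + l)) * (Polygamma 1 l - Polygamma 1 (a + b + l)) -
      (Polygamma 1 l - Polygamma 1 (a + l)) * (Polygamma 2 l - Polygamma 2 (a + b + l))) /
     (Polygamma 1 l - Polygamma 1 (a + b + l))^2"

context
  fixes a b :: real
  assumes ab: "a > 0" "b > 0"
begin

lemma trigamma_ratio_DERIV:
  assumes "l > 0"
  shows "(trigamma_ratio a b has_real_derivative trigamma_ratio_deriv a b l) (at l)"
proof -
  have "Polygamma 1 l - Polygamma 1 (a + b + l) > 0"
    using polygamma_gap_pos[of l "a + b"] assms ab by simp
  thus ?thesis
    unfolding trigamma_ratio_def[abs_def] trigamma_ratio_deriv_def using assms ab
    by (auto intro!: derivative_eq_intros simp: numeral_2_eq_2 add_pos_pos)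
qed

lemma trigamma_ratio_deriv_neg: "l > 0 \<Longrightarrow> trigamma_ratio_deriv a b l < 0"
  unfolding trigamma_ratio_deriv_def
  using polygamma_gap_wronskian[OF ab, of l] polygamma_gap_pos[of l "a + b"] ab
  by (intro divide_neg_pos) auto

lemma trigamma_ratio_strict_antimono:
  assumes "0 < x" "x < y"
  shows "trigamma_ratio a b y < trigamma_ratio a b x"
  using \<open>x < y\<close>
proof (rule DERIV_neg_imp_decreasing)
  fix z assume "x \<le> z"
  hence "z > 0" using assms by simp
  thus "\<exists>D. (trigamma_ratio a b has_real_derivative D) (at z) \<and> D < 0"
    using trigamma_ratio_DERIV trigamma_ratio_deriv_neg by blast
qed

lemma isCont_trigamma_ratio: "l > 0 \<Longrightarrow> isCont (trigamma_ratio a b) l"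
  using DERIV_isCont[OF trigamma_ratio_DERIV] .

text \<open>Numerator and denominator share the double pole of psi_1 at 0. The recurrence splits off
  1/l^2, and the ratio becomes 1 minus a bounded quantity over one that tends to infinity.\<close>

lemma trigamma_ratio_at_0: "(trigamma_ratio a b \<longlongrightarrow> 1) (at_right 0)"
proof -
  have nn: "a \<notin> \<int>\<^sub>\<le>\<^sub>0" "a + b \<notin> \<int>\<^sub>\<le>\<^sub>0" "1 \<notin> (\<int>\<^sub>\<le>\<^sub>0 :: real set)"
    using ab by (auto simp: add_pos_pos)
  have "((\<lambda>l. Polygamma 1 (l + 1) - Polygamma 1 (a + b + l)) \<longlongrightarrow>
      Polygamma 1 (0 + 1) - Polygamma 1 (a + b + 0)) (at_right (0::real))"
    using nn by (intro tendsto_intros) auto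
  moreover have "filterlim (\<lambda>l::real. 1 / l^2) at_top (at_right 0)"
    by real_asymp
  ultimately have "filterlim (\<lambda>l. (Polygamma 1 (l + 1) - Polygamma 1 (a + b + l)) + 1 / l^2)
      at_top (at_right (0::real))"
    by (rule filterlim_tendsto_add_at_top)
  moreover have "((\<lambda>l. Polygamma 1 (a + l) - Polygamma 1 (a + b + l)) \<longlongrightarrow>
      Polygamma 1 (a + 0) - Polygamma 1 (a + b + 0)) (at_right (0::real))"
    using nn by (intro tendsto_intros) auto
  ultimately have "((\<lambda>l. 1 - (Polygamma 1 (a + l) - Polygamma 1 (a + b + l)) /
      ((Polygamma 1 (l + 1) - Polygamma 1 (a + b + l)) + 1 / l^2)) \<longlongrightarrow> 1 - 0) (at_right 0)"
    by (intro tendsto_diff tendsto_const tendsto_divide_0[OF _ filterlim_at_top_imp_at_infinity])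
  moreover have "\<forall>\<^sub>F l in at_right 0. 1 - (Polygamma 1 (a + l) - Polygamma 1 (a + b + l)) /
      ((Polygamma 1 (l + 1) - Polygamma 1 (a + b + l)) + 1 / l^2) = trigamma_ratio a b l"
    using eventually_at_right_less[of 0]
  proof eventually_elim
    case (elim l)
    have "Polygamma 1 (l + 1) + 1 / l^2 = Polygamma 1 l"
      using elim by (simp add: Polygamma_plus1 numeral_2_eq_2)
    hence "Polygamma 1 (l + 1) - Polygamma 1 (a + b + l) + 1 / l^2 =
        Polygamma 1 l - Polygamma 1 (a + b + l)"
      by linarith
    thus ?case
      using polygamma_gap_pos[of l "a + b"] elim ab by (simp add: trigamma_ratio_def field_simps)
  qed
  ultimately show ?thesis
    using Lim_transform_eventually by fastforce
qed

lemma trigamma_ratio_inverse: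
  "u > 0 \<Longrightarrow> trigamma_ratio a b (1 / u) = trigamma_gap a 0 u / trigamma_gap (a + b) 0 u"
  by (simp add: trigamma_ratio_def trigamma_gap_def polygamma_gap_def)

lemma trigamma_ratio_at_top: "(trigamma_ratio a b \<longlongrightarrow> a / (a + b)) at_top"
proof -
  have "((\<lambda>u. trigamma_gap a 0 u / trigamma_gap (a + b) 0 u) \<longlongrightarrow>
      trigamma_gap_limit a 0 / trigamma_gap_limit (a + b) 0) (at_right 0)"
    using ab by (intro tendsto_divide trigamma_gap_tendsto) (auto simp: trigamma_gap_limit_def)
  hence "((\<lambda>x. trigamma_gap a 0 (inverse x) / trigamma_gap (a + b) 0 (inverse x)) \<longlongrightarrow>
      a / (a + b)) at_top"
    unfolding filterlim_at_right_to_top by (simp add: trigamma_gap_limit_def)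
  moreover have "\<forall>\<^sub>F x in at_top. trigamma_gap a 0 (inverse x) / trigamma_gap (a + b) 0 (inverse x) =
      trigamma_ratio a b x"
    using eventually_gt_at_top[of 0]
    by eventually_elim (use trigamma_ratio_inverse[of "inverse _"] in \<open>simp add: divide_inverse\<close>)
  ultimately show ?thesis
    by (rule Lim_transform_eventually)
qed

lemma trigamma_ratio_bounds:
  assumes "l > 0"
  shows "trigamma_ratio a b l \<in> {a / (a + b)<..<1}"
proof -
  \<comment> \<open>The limit at infinity yields only a weak inequality. Taking it at l + 1 leaves
    room for strict monotonicity between l and l + 1.\<close>
  have "a / (a + b) \<le> trigamma_ratio a b (l + 1)"
  proof (rule tendsto_upperbound[OF trigamma_ratio_at_top])
    show "\<forall>\<^sub>F x in at_top. trigamma_ratio a b x \<le> trigamma_ratio a b (l + 1)"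
      using eventually_gt_at_top[of "l + 1"]
      by eventually_elim (use assms in \<open>auto intro!: less_imp_le trigamma_ratio_strict_antimono\<close>)
  qed auto
  also have "\<dots> < trigamma_ratio a b l"
    using assms by (intro trigamma_ratio_strict_antimono) auto
  finally have "a / (a + b) < trigamma_ratio a b l" .
  moreover have "trigamma_ratio a b l < 1"
    using polygamma_gap_pos[of l "a + b"] polygamma_gap_pos[of "a + l" b] assms ab
    by (simp add: trigamma_ratio_def add_ac)
  ultimately show ?thesis by simp
qed

lemma rate_param_trigamma_ratio:
  assumes "l > 0"
  shows "rate_param a b (trigamma_ratio a b l) = l"
  unfolding rate_param_def trigamma_ratio_def[symmetric]
proof (rule the_equality)
  fix l' assume l': "0 < l' \<and> trigamma_ratio a b l = trigamma_ratio a b l'"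
  thus "l' = l"
    using trigamma_ratio_strict_antimono[of l l'] trigamma_ratio_strict_antimono[of l' l] assms
    by (cases l l' rule: linorder_cases) auto
qed (use assms in auto)

lemma trigamma_ratio_surj:
  assumes "t \<in> {a / (a + b)<..<1}"
  obtains l where "l > 0" "trigamma_ratio a b l = t"
proof -
  have "\<forall>\<^sub>F l in at_right 0. trigamma_ratio a b l > t \<and> l > 0"
    using assms by (intro eventually_conj order_tendstoD(1)[OF trigamma_ratio_at_0])
      (auto simp: eventually_at_right_less)
  then obtain l1 where l1: "l1 > 0" "trigamma_ratio a b l1 > t"
    using eventually_happens'[of "at_right (0::real)"] by (auto simp: trivial_limit_at_right_real)
  have "\<forall>\<^sub>F l in at_top. trigamma_ratio a b l < t \<and> l > l1"
    using assms by (intro eventually_conj order_tendstoD(2)[OF trigamma_ratio_at_top])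
      (auto simp: eventually_gt_at_top)
  then obtain l2 where l2: "l2 > l1" "trigamma_ratio a b l2 < t"
    using eventually_happens'[of "at_top :: real filter"] by auto
  have "\<exists>x\<ge>l1. x \<le> l2 \<and> trigamma_ratio a b x = t"
    using l1 l2 by (intro IVT2) (auto intro!: isCont_trigamma_ratio)
  then obtain x where "x \<ge> l1" "trigamma_ratio a b x = t"
    by blast
  thus ?thesis
    using l1 by (intro that[of x]) auto
qed

lemma rate_param:
  assumes "t \<in> {a / (a + b)<..<1}"
  shows "rate_param a b t > 0" "trigamma_ratio a b (rate_param a b t) = t"
proof -
  obtain l where l: "l > 0" "trigamma_ratio a b l = t"
    using trigamma_ratio_surj[OF assms] .
  thus "rate_param a b t > 0" "trigamma_ratio a b (rate_param a b t) = t"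
    using rate_param_trigamma_ratio[OF l(1)] by auto
qed

lemma isCont_rate_param:
  assumes t: "t \<in> {a / (a + b)<..<1}"
  shows "isCont (rate_param a b) t"
proof -
  define l where "l = rate_param a b t"
  have l: "l > 0" "trigamma_ratio a b l = t"
    unfolding l_def using rate_param[OF t] by auto
  have "isCont (rate_param a b) (trigamma_ratio a b l)"
  \<comment> \<open>The radius l/2 keeps the neighbourhood of l among positive parameters, where the
    ratio is continuous and injective.\<close>
  proof (rule isCont_inverse_function[where f = "trigamma_ratio a b" and x = l and d = "l / 2"])
    show "0 < l / 2" using l by simp
    show "rate_param a b (trigamma_ratio a b z) = z" if "\<bar>z - l\<bar> \<le> l / 2" for z
      using that l by (intro rate_param_trigamma_ratio) (auto simp: abs_if split: if_splits)
    show "isCont (trigamma_ratio a b) z" if "\<bar>z - l\<bar> \<le> l / 2" for z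
      using that l by (intro isCont_trigamma_ratio) (auto simp: abs_if split: if_splits)
  qed
  thus ?thesis using l by simp
qed

lemma rate_param_at_top: "filterlim (rate_param a b) at_top (at_right (a / (a + b)))"
  unfolding filterlim_at_top_gt[where c = 0]
proof safe
  fix B :: real assume B: "B > 0"
  have "trigamma_ratio a b B \<in> {a / (a + b)<..<1}"
    using trigamma_ratio_bounds[OF B] .
  hence "\<forall>\<^sub>F t in at_right (a / (a + b)). t \<in> {a / (a + b)<..<trigamma_ratio a b B}"
    by (intro eventually_at_right_real) auto
  thus "\<forall>\<^sub>F t in at_right (a / (a + b)). B \<le> rate_param a b t"
  proof eventually_elim
    case (elim t)
    have t: "t \<in> {a / (a + b)<..<1}"
      using elim trigamma_ratio_bounds[OF B] by auto
    show ?case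
    proof (rule ccontr)
      assume "\<not> B \<le> rate_param a b t"
      hence "trigamma_ratio a b B < trigamma_ratio a b (rate_param a b t)"
        using rate_param(1)[OF t] by (intro trigamma_ratio_strict_antimono) auto
      thus False
        using rate_param(2)[OF t] elim by simp
    qed
  qed
qed

end

subsection \<open>Derivatives of the quenched rate to the right of the minimum\<close>

definition right_rate :: "real \<Rightarrow> real \<Rightarrow> real \<Rightarrow> real" where
  "right_rate a b t =
     (let l = rate_param a b t in t * Digamma (a + b + l) + (1 - t) * Digamma l - Digamma (a + l))"

text \<open>
  The derivatives of order \<open>k + 2\<close> of the rate, when the direction is \<open>t = n/d\<close> and the first
  derivative of the rate is an antiderivative of \<open>d\<close>, all with respect to \<open>u\<close>. Here \<open>n i\<close> and
  \<open>d i\<close> are the \<open>i\<close>-th derivatives, and \<open>w = n' d - n d'\<close>, so that \<open>du/dt = d\<^sup>2/w\<close>.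
\<close>
definition rate_derivative :: "nat \<Rightarrow> (nat \<Rightarrow> real) \<Rightarrow> (nat \<Rightarrow> real) \<Rightarrow> real" where
  "rate_derivative k n d =
     (let w = n 1 * d 0 - n 0 * d 1;
          w' = n 2 * d 0 - n 0 * d 2;
          w'' = n 3 * d 0 + n 2 * d 1 - n 1 * d 2 - n 0 * d 3
      in [d 0 ^ 3 / w,
          (3 * d 0 ^ 4 * d 1 * w - d 0 ^ 5 * w') / w ^ 3,
          ((12 * d 0 ^ 3 * d 1 ^ 2 * w + 3 * d 0 ^ 4 * d 2 * w - 2 * d 0 ^ 4 * d 1 * w' - d 0 ^ 5 * w'') * w
           - 3 * (3 * d 0 ^ 4 * d 1 * w - d 0 ^ 5 * w') * w') / w ^ 4 * (d 0 ^ 2 / w)] ! k)"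

text \<open>Candidates for the successive t-derivatives of \<open>right_rate\<close>. They are
  meaningful up to order 4, since the list in \<open>rate_derivative\<close> has three
  entries.\<close>

definition right_rate_chain :: "real \<Rightarrow> real \<Rightarrow> nat \<Rightarrow> real \<Rightarrow> real" where
  "right_rate_chain a b k t =
     (let l = rate_param a b t in
      if k = 0 then right_rate a b t
      else if k = 1 then Digamma (a + b + l) - Digamma l
      else rate_derivative (k - 2) (\<lambda>i. trigamma_gap a i (1 / l)) (\<lambda>i. trigamma_gap (a + b) i (1 / l)))"

text \<open>Derivatives at the minimum rather than Taylor coefficients; the factorials enter only
  with the Taylor sum.\<close>

definition rate_coeff :: "real \<Rightarrow> real \<Rightarrow> nat \<Rightarrow> real" where
  "rate_coeff a b k =
     [0, 0, (a + b)^2 / (a * b), (a + b)^3 * (a - b) / (a^2 * b^2),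
      (a + b)^4 * (2 * a^2 - 2 * a * b + 2 * b^2 + 1) / (a^3 * b^3)] ! k"

text \<open>Each entry is differentiated in u by the quotient rule and then multiplied by du/dt.
  Keeping \<open>n\<close> and \<open>d\<close> abstract separates this algebra from the polygamma
  functions.\<close>

lemma rate_derivative_DERIV:
  fixes n d :: "nat \<Rightarrow> real \<Rightarrow> real" and x :: "real \<Rightarrow> real"
  assumes n: "\<And>i. i < 3 \<Longrightarrow> (n i has_real_derivative n (Suc i) (x t)) (at (x t))"
    and d: "\<And>i. i < 3 \<Longrightarrow> (d i has_real_derivative d (Suc i) (x t)) (at (x t))"
    and x: "(x has_real_derivative d 0 (x t) ^ 2 / (n 1 (x t) * d 0 (x t) - n 0 (x t) * d 1 (x t))) (at t)"
    and w: "n 1 (x t) * d 0 (x t) - n 0 (x t) * d 1 (x t) \<noteq> 0"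
    and "k < 2"
  shows "((\<lambda>t. rate_derivative k (\<lambda>i. n i (x t)) (\<lambda>i. d i (x t))) has_real_derivative
           rate_derivative (Suc k) (\<lambda>i. n i (x t)) (\<lambda>i. d i (x t))) (at t)"
proof -
  define w where "w = (\<lambda>u. n 1 u * d 0 u - n 0 u * d 1 u)"
  define w' where "w' = (\<lambda>u. n 2 u * d 0 u - n 0 u * d 2 u)"
  define w'' where "w'' = (\<lambda>u. n 3 u * d 0 u + n 2 u * d 1 u - n 1 u * d 2 u - n 0 u * d 3 u)"
  define u where "u = x t"
  note nd = n[folded u_def] d[folded u_def]
  have [derivative_intros]: "(w has_real_derivative w' u) (at u)"
    unfolding w_def w'_def using nd[of 0] nd[of 1]
    by (auto intro!: derivative_eq_intros simp: numeral_2_eq_2)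
  have [derivative_intros]: "(w' has_real_derivative w'' u) (at u)"
    unfolding w'_def w''_def using nd[of 0] nd[of 2]
    by (auto intro!: derivative_eq_intros simp: eval_nat_numeral)
  have [derivative_intros]: "(d 0 has_real_derivative d 1 u) (at u)"
    "(d (Suc 0) has_real_derivative d 2 u) (at u)"
    using nd(2)[of 0] nd(2)[of 1] by (auto simp: eval_nat_numeral)
  have w0: "w u \<noteq> 0"
    using w by (simp add: w_def u_def)
  have x': "(x has_real_derivative d 0 u ^ 2 / w u) (at t)"
    using x by (simp add: w_def u_def)
  consider "k = 0" | "k = 1" using \<open>k < 2\<close> by linarith
  thus ?thesis
  proof cases
    assume k: "k = 0"
    have "((\<lambda>u. d 0 u ^ 3 / w u) has_real_derivative
        (3 * d 0 u ^ 2 * d 1 u * w u - d 0 u ^ 3 * w' u) / (w u)\<^sup>2) (at u)"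
      using w0 by (auto intro!: derivative_eq_intros simp: power2_eq_square)
    from DERIV_chain2[OF this[unfolded u_def] x'[unfolded u_def]]
    have "((\<lambda>t. d 0 (x t) ^ 3 / w (x t)) has_real_derivative
        (3 * d 0 u ^ 2 * d 1 u * w u - d 0 u ^ 3 * w' u) / (w u)\<^sup>2 * (d 0 u ^ 2 / w u)) (at t)"
      by (simp add: u_def)
    also have "(3 * d 0 u ^ 2 * d 1 u * w u - d 0 u ^ 3 * w' u) / (w u)\<^sup>2 * (d 0 u ^ 2 / w u) =
        (3 * d 0 u ^ 4 * d 1 u * w u - d 0 u ^ 5 * w' u) / w u ^ 3"
      using w0 by (simp add: field_simps eval_nat_numeral)
    finally show ?thesis
      by (simp add: k rate_derivative_def Let_def w_def w'_def u_def)
  next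
    assume k: "k = 1"
    define A where "A = (\<lambda>u. 3 * d 0 u ^ 4 * d 1 u * w u - d 0 u ^ 5 * w' u)"
    \<comment> \<open>The two terms in \<open>d 1 * w'\<close>, with coefficients 3 from the first
      summand and -5 from the second, combine to -2.\<close>
    define A' where "A' = 12 * d 0 u ^ 3 * d 1 u ^ 2 * w u + 3 * d 0 u ^ 4 * d 2 u * w u
        - 2 * d 0 u ^ 4 * d 1 u * w' u - d 0 u ^ 5 * w'' u"
    have [derivative_intros]: "(A has_real_derivative A') (at u)"
      unfolding A_def A'_def
      by (auto intro!: derivative_eq_intros simp: algebra_simps power2_eq_square)
    have "((\<lambda>u. A u / w u ^ 3) has_real_derivative (A' * w u - 3 * A u * w' u) / w u ^ 4) (at u)"
      using w0 by (auto intro!: derivative_eq_intros simp: divide_simps)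
        (simp add: algebra_simps eval_nat_numeral)
    from DERIV_chain2[OF this[unfolded u_def] x'[unfolded u_def]]
    have "((\<lambda>t. A (x t) / w (x t) ^ 3) has_real_derivative
        (A' * w u - 3 * A u * w' u) / w u ^ 4 * (d 0 u ^ 2 / w u)) (at t)"
      by (simp add: u_def)
    thus ?thesis
      by (simp add: k rate_derivative_def Let_def w_def w'_def w''_def A_def A'_def u_def)
  qed
qed

text \<open>The filter is general because this serves twice: with \<open>at t\<close> for continuity
  away from the minimum, and with \<open>at_right\<close> for the limit at it.\<close>

lemma rate_derivative_tendsto:
  assumes "\<And>i. i \<le> 3 \<Longrightarrow> ((\<lambda>x. n i x) \<longlongrightarrow> N i) F" "\<And>i. i \<le> 3 \<Longrightarrow> ((\<lambda>x. d i x) \<longlongrightarrow> D i) F"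
    and w: "N 1 * D 0 - N 0 * D 1 \<noteq> 0" and "k \<le> 2"
  shows "((\<lambda>x. rate_derivative k (\<lambda>i. n i x) (\<lambda>i. d i x)) \<longlongrightarrow> rate_derivative k N D) F"
proof -
  have "k = 0 \<or> k = 1 \<or> k = 2" using assms by auto
  thus ?thesis
    unfolding rate_derivative_def Let_def
    by (elim disjE; simp only: nth_Cons_0 nth_Cons_Suc One_nat_def numeral_2_eq_2 ;
      intro tendsto_intros assms(1,2) power_not_zero; use w in \<open>simp add: eval_nat_numeral\<close>)
qed

text \<open>In the limit w, w' and w'' all contain the factor a b (a + b); \<open>v\<close> and
  \<open>z\<close> are the cofactors of w' and w''. Extracting it cancels the powers of w and leaves
  polynomial identities.\<close>

lemma rate_derivative_limit:
  assumes "a > 0" "b > 0" "k \<in> {2..4}"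
  shows "rate_derivative (k - 2) (trigamma_gap_limit a) (trigamma_gap_limit (a + b)) = rate_coeff a b k"
proof -
  have w: "trigamma_gap_limit a 1 * trigamma_gap_limit (a + b) 0 -
      trigamma_gap_limit a 0 * trigamma_gap_limit (a + b) 1 = a * b * (a + b)"
    by (simp add: trigamma_gap_limit_def algebra_simps)
  define v where "v = 3 - 4 * a - 2 * b"
  have w': "trigamma_gap_limit a 2 * trigamma_gap_limit (a + b) 0 -
      trigamma_gap_limit a 0 * trigamma_gap_limit (a + b) 2 = a * b * (a + b) * v"
    by (simp add: trigamma_gap_limit_def v_def) (simp add: algebra_simps power2_eq_square)
  define z where "z = 6 - 12 * (2 * a + b) + 6 * ((a + b)^2 + (a + b) * a + a^2) + 2 * (1 - a) * (1 - a - b)"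
  have w'': "trigamma_gap_limit a 3 * trigamma_gap_limit (a + b) 0 +
      trigamma_gap_limit a 2 * trigamma_gap_limit (a + b) 1 -
      trigamma_gap_limit a 1 * trigamma_gap_limit (a + b) 2 -
      trigamma_gap_limit a 0 * trigamma_gap_limit (a + b) 3 = a * b * (a + b) * z"
    by (simp add: trigamma_gap_limit_def z_def) (simp add: algebra_simps power2_eq_square)
  define s r where "s = a + b" and "r = 1 - s"
  have d: "trigamma_gap_limit (a + b) 0 = s" "trigamma_gap_limit (a + b) 1 = s * r"
    "trigamma_gap_limit (a + b) 2 = s * r * (1 - 2 * s)"
    by (simp_all add: trigamma_gap_limit_def s_def r_def)
  have ab: "a \<noteq> 0" "b \<noteq> 0" "s \<noteq> 0"
    using assms by (auto simp: s_def)
  have "k = 2 \<or> k = 3 \<or> k = 4" using assms by auto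
  thus ?thesis
  proof (elim disjE)
    assume "k = 2"
    thus ?thesis
      unfolding rate_derivative_def w w' w'' Let_def unfolding d
      using ab by (simp add: rate_coeff_def s_def[symmetric] field_simps eval_nat_numeral)
  next
    assume k: "k = 3"
    have "(3 * s ^ 4 * (s * r) * (a * b * s) - s ^ 5 * (a * b * s * v)) / (a * b * s) ^ 3 =
        s ^ 3 * (3 * r - v) / (a^2 * b^2)"
      using ab by (simp add: divide_simps) (simp add: algebra_simps eval_nat_numeral)
    also have "3 * r - v = a - b"
      by (simp add: r_def s_def v_def)
    finally show ?thesis
      unfolding rate_derivative_def w w' w'' Let_def unfolding d
      by (simp add: k rate_coeff_def s_def)
  next
    assume k: "k = 4"
    define q where "q = 1 - 2 * s"
    have "((12 * s ^ 3 * (s * r) ^ 2 * (a * b * s) + 3 * s ^ 4 * (s * r * q) * (a * b * s)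
          - 2 * s ^ 4 * (s * r) * (a * b * s * v) - s ^ 5 * (a * b * s * z)) * (a * b * s)
          - 3 * (3 * s ^ 4 * (s * r) * (a * b * s) - s ^ 5 * (a * b * s * v)) * (a * b * s * v))
          / (a * b * s) ^ 4 * (s ^ 2 / (a * b * s)) =
        s ^ 4 * (12 * r^2 + 3 * r * q - 2 * r * v - z - 3 * (3 * r - v) * v) / (a^3 * b^3)"
      using ab by (simp add: divide_simps) (simp add: algebra_simps eval_nat_numeral)
    \<comment> \<open>The linear terms cancel and the constant terms give 12 + 3 - 6 - 8 = 1, the
      summand by which the quenched and averaged fourth derivatives differ.\<close>
    also have "12 * r^2 + 3 * r * q - 2 * r * v - z - 3 * (3 * r - v) * v = 2 * a^2 - 2 * a * b + 2 * b^2 + 1"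
      by (simp add: r_def s_def v_def z_def q_def) (simp add: algebra_simps power2_eq_square)
    finally show ?thesis
      unfolding rate_derivative_def w w' w'' Let_def unfolding d
      by (simp add: k rate_coeff_def s_def q_def)
  qed
qed

lemma isCont_trigamma_gap:
  assumes "u > 0" "s \<ge> 0" "k \<le> 3"
  shows "isCont (trigamma_gap s k) u"
proof -
  have "isCont (polygamma_gap s j) u" for j
    using polygamma_gap_DERIV[OF assms(1,2)] by (rule DERIV_isCont)
  moreover have "k = 0 \<or> k = 1 \<or> k = 2 \<or> k = 3" using assms by auto
  ultimately show ?thesis
    unfolding trigamma_gap_def[abs_def] Let_def using assms(1)
    by (elim disjE) (auto intro!: continuous_intros)
qed

text \<open>Orders 0 and 1 of the rate are combinations of such differences. The mean value theorem
  bounds them by s psi_1(l), as psi_1 is positive and decreasing, and a coarse telescoping with 1/x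
  shows that psi_1 vanishes at infinity.\<close>

lemma Digamma_diff_tendsto_0:
  assumes "s > 0"
  shows "((\<lambda>l. Digamma (s + l) - Digamma l) \<longlongrightarrow> 0) (at_top :: real filter)"
proof -
  have "(Polygamma 1 :: real \<Rightarrow> real) \<in> O(\<lambda>x. 1 / x)"
  proof (rule bigo_telescope)
    have "(\<lambda>x::real. 1 / x^2) \<in> O(\<lambda>x. 1 / x - 1 / (x + 1))"
      by real_asymp
    moreover have "\<forall>\<^sub>F x::real in at_top. Polygamma 1 x - Polygamma 1 (x + 1) = 1 / x^2"
      using eventually_gt_at_top[of 0] by eventually_elim (simp add: Polygamma_plus1 numeral_2_eq_2)
    ultimately show "(\<lambda>x::real. Polygamma 1 x - Polygamma 1 (x + 1)) \<in> O(\<lambda>x. 1 / x - 1 / (x + 1))"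
      by (subst landau_o.big.in_cong) auto
  qed (auto intro!: Polygamma_plus_of_nat_tendsto_0 divide_left_mono)
  moreover have "(\<lambda>x::real. 1 / x) \<in> o(\<lambda>_. 1)"
    by real_asymp
  ultimately have "(Polygamma 1 :: real \<Rightarrow> real) \<in> o(\<lambda>_. 1)"
    by (rule landau_o.big_small_trans)
  hence "((Polygamma 1 :: real \<Rightarrow> real) \<longlongrightarrow> 0) at_top"
    using smalloD_tendsto by fastforce
  hence lim: "((\<lambda>l::real. s * Polygamma 1 l) \<longlongrightarrow> 0) at_top"
    by (rule tendsto_mult_right_zero)
  show ?thesis
  proof (rule Lim_null_comparison[OF _ lim])
    show "\<forall>\<^sub>F l::real in at_top. norm (Digamma (s + l) - Digamma l) \<le> s * Polygamma 1 l"
      using eventually_gt_at_top[of 0]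
    proof eventually_elim
      case (elim l)
      have "\<exists>z>l. z < s + l \<and> Digamma (s + l) - Digamma l = (s + l - l) * Polygamma 1 z"
        using elim assms by (intro MVT2) (auto intro!: derivative_eq_intros)
      then obtain z where z: "z > l" "Digamma (s + l) - Digamma l = s * Polygamma 1 z"
        by auto
      moreover have "Polygamma 1 z \<le> Polygamma 1 l" "Polygamma 1 z > 0"
        using z elim Polygamma_real_strict_antimono[of l z 1] Polygamma_real_odd_pos[of z 1] by auto
      ultimately show ?case
        using assms by simp
    qed
  qed
qed

context
  fixes a b :: real
  assumes ab: "a > 0" "b > 0"
begin

lemma trigamma_gap_0_pos: "u > 0 \<Longrightarrow> s > 0 \<Longrightarrow> trigamma_gap s 0 u > 0"
  using polygamma_gap_pos[of "1 / u" s] by (simp add: trigamma_gap_def polygamma_gap_def)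

text \<open>The products of two psi_1-gaps cancel, leaving the Wronskian of the polygamma gaps over
  u^6.\<close>

lemma trigamma_gap_wronskian_pos:
  assumes "u > 0"
  shows "trigamma_gap a 1 u * trigamma_gap (a + b) 0 u - trigamma_gap a 0 u * trigamma_gap (a + b) 1 u > 0"
proof -
  have "trigamma_gap a 1 u * trigamma_gap (a + b) 0 u - trigamma_gap a 0 u * trigamma_gap (a + b) 1 u =
      (polygamma_gap a 1 u * polygamma_gap (a + b) 2 u - polygamma_gap a 2 u * polygamma_gap (a + b) 1 u) / u ^ 6"
    using assms by (simp add: trigamma_gap_def divide_simps) (simp add: algebra_simps eval_nat_numeral)
  moreover have "polygamma_gap a 2 u * polygamma_gap (a + b) 1 u < polygamma_gap a 1 u * polygamma_gap (a + b) 2 u"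
    using polygamma_gap_wronskian[OF ab, of "1 / u"] assms by (simp add: polygamma_gap_def)
  ultimately show ?thesis
    using assms by simp
qed

text \<open>As a function of t, u inverts the direction n/d, so its derivative is the reciprocal of
  (n/d)' = w/d^2.\<close>

lemma inverse_rate_param_DERIV:
  assumes t: "t \<in> {a / (a + b)<..<1}"
  defines "x \<equiv> \<lambda>t. 1 / rate_param a b t"
  shows "(x has_real_derivative trigamma_gap (a + b) 0 (x t) ^ 2 /
     (trigamma_gap a 1 (x t) * trigamma_gap (a + b) 0 (x t) -
      trigamma_gap a 0 (x t) * trigamma_gap (a + b) 1 (x t))) (at t)"
proof -
  have xpos: "x y > 0" if "y \<in> {a / (a + b)<..<1}" for y
    using rate_param(1)[OF ab that] by (simp add: x_def)
  define D where "D = (trigamma_gap a 1 (x t) * trigamma_gap (a + b) 0 (x t) -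
      trigamma_gap a 0 (x t) * trigamma_gap (a + b) 1 (x t)) / trigamma_gap (a + b) 0 (x t) ^ 2"
  have dpos: "trigamma_gap (a + b) 0 (x t) > 0"
    using xpos[OF t] ab by (intro trigamma_gap_0_pos) auto
  have "(x has_real_derivative inverse D) (at t)"
  proof (rule DERIV_inverse_function[where f = "\<lambda>u. trigamma_gap a 0 u / trigamma_gap (a + b) 0 u"])
    show "((\<lambda>u. trigamma_gap a 0 u / trigamma_gap (a + b) 0 u) has_real_derivative D) (at (x t))"
      unfolding D_def using xpos[OF t] ab dpos
      by (auto intro!: derivative_eq_intros trigamma_gap_DERIV simp: power2_eq_square)
    show "D \<noteq> 0"
      using trigamma_gap_wronskian_pos[OF xpos[OF t]] dpos by (simp add: D_def)
    show "isCont x t"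
      unfolding x_def using isCont_rate_param[OF ab t] rate_param(1)[OF ab t]
      by (intro continuous_intros) auto
    show "trigamma_gap a 0 (x y) / trigamma_gap (a + b) 0 (x y) = y" if "a / (a + b) < y" "y < 1" for y
      using trigamma_ratio_inverse[OF ab xpos[of y]] rate_param(2)[OF ab, of y] that
      by (simp add: x_def)
  qed (use t in auto)
  thus ?thesis by (simp add: D_def)
qed

lemma right_rate_chain_DERIV:
  assumes t: "t \<in> {a / (a + b)<..<1}" and "k < 4"
  shows "(right_rate_chain a b k has_real_derivative right_rate_chain a b (Suc k) t) (at t)"
proof -
  define l where "l = rate_param a b t"
  define x where "x = (\<lambda>t. 1 / rate_param a b t)"
  have l: "l > 0" "trigamma_ratio a b l = t"
    unfolding l_def using rate_param[OF ab t] by auto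
  define d n where "d = trigamma_gap (a + b)" and "n = trigamma_gap a"
  have xt: "x t = 1 / l" "x t > 0" using l by (simp_all add: x_def l_def)
  define w where "w = n 1 (x t) * d 0 (x t) - n 0 (x t) * d 1 (x t)"
  have w: "w > 0"
    using trigamma_gap_wronskian_pos[OF xt(2)] by (simp add: w_def n_def d_def)
  have x: "(x has_real_derivative d 0 (x t) ^ 2 / w) (at t)"
    using inverse_rate_param_DERIV[OF t] by (simp add: x_def d_def n_def w_def)
  define P where "P = Polygamma 1 l - Polygamma 1 (a + b + l)"
  have P: "P > 0" using polygamma_gap_pos[of l "a + b"] ab l by (simp add: P_def)
  have dP: "d 0 (x t) = P * l^2"
    using l by (simp add: d_def xt trigamma_gap_def polygamma_gap_def P_def power_one_over field_simps)
  \<comment> \<open>The derivative of l = 1/x in t, namely -x'/x^2.\<close>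
  define l' where "l' = - (l^2 * (d 0 (x t) ^ 2 / w))"
  have "((\<lambda>t. 1 / x t) has_real_derivative l') (at t)"
    unfolding l'_def using xt l(1) by (auto intro!: derivative_eq_intros x simp: power2_eq_square)
  hence L: "(rate_param a b has_real_derivative l') (at t)"
    by (simp add: x_def)
  have nn: "l \<notin> \<int>\<^sub>\<le>\<^sub>0" "a + l \<notin> \<int>\<^sub>\<le>\<^sub>0" "a + b + l \<notin> \<int>\<^sub>\<le>\<^sub>0"
    using l ab by (auto simp: add_pos_pos)
  consider "k = 0" | "k = 1" | "k \<in> {2, 3}" using \<open>k < 4\<close> by force
  thus ?thesis
  proof cases
    assume k: "k = 0"
    have "((\<lambda>t. t * Digamma (a + b + rate_param a b t) + (1 - t) * Digamma (rate_param a b t)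
        - Digamma (a + rate_param a b t)) has_real_derivative
        Digamma (a + b + l) - Digamma l + l' * (Polygamma 1 l - Polygamma 1 (a + l) - t * P)) (at t)"
      using nn unfolding P_def l_def
      by (auto intro!: derivative_eq_intros L simp: algebra_simps)
    moreover have "Polygamma 1 l - Polygamma 1 (a + l) - t * P = 0"
      using l(2) P by (simp add: trigamma_ratio_def P_def field_simps)
    moreover have "right_rate_chain a b 0 = (\<lambda>t. t * Digamma (a + b + rate_param a b t)
        + (1 - t) * Digamma (rate_param a b t) - Digamma (a + rate_param a b t))"
      by (simp add: right_rate_chain_def right_rate_def Let_def fun_eq_iff)
    ultimately show ?thesis
      by (simp add: k right_rate_chain_def l_def Let_def)
  next
    assume k: "k = 1"
    have "((\<lambda>t. Digamma (a + b + rate_param a b t) - Digamma (rate_param a b t)) has_real_derivative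
        - (l' * P)) (at t)"
      using nn unfolding P_def l_def
      by (auto intro!: derivative_eq_intros L simp: algebra_simps)
    \<comment> \<open>The factors P and l^2 combine to \<open>d 0\<close> by \<open>dP\<close>,
      which turns the square of \<open>d 0\<close> into a cube.\<close>
    moreover have "- (l' * P) = rate_derivative 0 (\<lambda>i. n i (x t)) (\<lambda>i. d i (x t))"
    proof -
      have "rate_derivative 0 (\<lambda>i. n i (x t)) (\<lambda>i. d i (x t)) = d 0 (x t) ^ 3 / w"
        by (simp add: rate_derivative_def w_def)
      thus ?thesis
        by (simp add: l'_def dP power2_eq_square power3_eq_cube mult_ac)
    qed
    moreover have "right_rate_chain a b k = (\<lambda>t. Digamma (a + b + rate_param a b t) - Digamma (rate_param a b t))"
      by (simp add: right_rate_chain_def k Let_def fun_eq_iff)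
    ultimately show ?thesis
      by (simp add: k right_rate_chain_def Let_def n_def d_def x_def)
  next
    assume k: "k \<in> {2, 3}"
    have "((\<lambda>t. rate_derivative (k - 2) (\<lambda>i. n i (x t)) (\<lambda>i. d i (x t))) has_real_derivative
        rate_derivative (Suc (k - 2)) (\<lambda>i. n i (x t)) (\<lambda>i. d i (x t))) (at t)"
      using x w xt(2) k ab unfolding w_def
      by (intro rate_derivative_DERIV) (auto simp: n_def d_def intro!: trigamma_gap_DERIV)
    moreover have "right_rate_chain a b k = (\<lambda>t. rate_derivative (k - 2) (\<lambda>i. n i (x t)) (\<lambda>i. d i (x t)))"
      using k by (auto simp: right_rate_chain_def Let_def fun_eq_iff n_def d_def x_def)
    ultimately show ?thesis
      using k by (auto simp: right_rate_chain_def Let_def n_def d_def x_def eval_nat_numeral)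
  qed
qed

lemma isCont_right_rate_chain:
  assumes "k \<in> {2..4}" and t: "t \<in> {a / (a + b)<..<1}"
  shows "isCont (right_rate_chain a b k) t"
proof -
  define x where "x = (\<lambda>t. 1 / rate_param a b t)"
  have x: "x t > 0"
    using rate_param(1)[OF ab t] by (simp add: x_def)
  have cont: "isCont x t"
    using inverse_rate_param_DERIV[OF t] unfolding x_def by (rule DERIV_isCont)
  have eq: "right_rate_chain a b k =
      (\<lambda>t. rate_derivative (k - 2) (\<lambda>i. trigamma_gap a i (x t)) (\<lambda>i. trigamma_gap (a + b) i (x t)))"
    using assms by (auto simp: right_rate_chain_def Let_def fun_eq_iff x_def)
  have "trigamma_gap a 1 (x t) * trigamma_gap (a + b) 0 (x t) -
      trigamma_gap a 0 (x t) * trigamma_gap (a + b) 1 (x t) \<noteq> 0"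
    using trigamma_gap_wronskian_pos[OF x] by simp
  moreover have "((\<lambda>y. trigamma_gap s i (x y)) \<longlongrightarrow> trigamma_gap s i (x t)) (at t)" if "s > 0" "i \<le> 3" for s i
    using isCont_o2[OF cont isCont_trigamma_gap[of "x t" s i]] x that by (simp add: isCont_def)
  ultimately show ?thesis
    unfolding isCont_def eq using assms ab
    by (intro rate_derivative_tendsto) auto
qed

lemma right_rate_chain_tendsto:
  assumes "k \<le> 4"
  shows "(right_rate_chain a b k \<longlongrightarrow> rate_coeff a b k) (at_right (a / (a + b)))"
proof -
  define F where "F = at_right (a / (a + b))"
  have L: "filterlim (rate_param a b) at_top F"
    unfolding F_def by (rule rate_param_at_top[OF ab])
  have dig: "((\<lambda>t. Digamma (s + rate_param a b t) - Digamma (rate_param a b t)) \<longlongrightarrow> 0) F" if "s > 0" for s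
    by (rule filterlim_compose[OF Digamma_diff_tendsto_0[OF that] L])
  have "filterlim (\<lambda>t. inverse (rate_param a b t)) (at_right 0) F"
    by (rule filterlim_compose[OF filterlim_inverse_at_right_top L])
  hence x: "filterlim (\<lambda>t. 1 / rate_param a b t) (at_right 0) F"
    by (simp add: divide_inverse)
  consider "k = 0" | "k = 1" | "k \<in> {2..4}" using \<open>k \<le> 4\<close> by force
  hence "(right_rate_chain a b k \<longlongrightarrow> rate_coeff a b k) F"
  proof cases
    assume k: "k = 0"
    have "((\<lambda>t. t) \<longlongrightarrow> a / (a + b)) F"
      unfolding F_def by (rule tendsto_ident_at)
    \<comment> \<open>The weights t, 1 - t and -1 add up to 0, so the divergent
      \<open>Digamma l\<close> can be subtracted from every term.\<close>
    hence "((\<lambda>t. t * (Digamma (a + b + rate_param a b t) - Digamma (rate_param a b t)) -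
        (Digamma (a + rate_param a b t) - Digamma (rate_param a b t))) \<longlongrightarrow> 0) F"
      using tendsto_diff[OF tendsto_mult[OF _ dig[of "a + b"]] dig[of a]] ab by fastforce
    also have "(\<lambda>t. t * (Digamma (a + b + rate_param a b t) - Digamma (rate_param a b t)) -
        (Digamma (a + rate_param a b t) - Digamma (rate_param a b t))) = right_rate_chain a b 0"
      by (simp add: fun_eq_iff right_rate_chain_def right_rate_def Let_def algebra_simps)
    finally show ?thesis
      by (simp add: k rate_coeff_def)
  next
    assume k: "k = 1"
    have "right_rate_chain a b k = (\<lambda>t. Digamma (a + b + rate_param a b t) - Digamma (rate_param a b t))"
      by (simp add: right_rate_chain_def k Let_def fun_eq_iff)
    thus ?thesis
      using dig[of "a + b"] ab by (simp add: k rate_coeff_def)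
  next
    assume k: "k \<in> {2..4}"
    have "trigamma_gap_limit a 1 * trigamma_gap_limit (a + b) 0 -
        trigamma_gap_limit a 0 * trigamma_gap_limit (a + b) 1 = a * b * (a + b)"
      by (simp add: trigamma_gap_limit_def algebra_simps)
    also have "\<dots> \<noteq> 0" using ab by auto
    finally have "((\<lambda>t. rate_derivative (k - 2) (\<lambda>i. trigamma_gap a i (1 / rate_param a b t))
        (\<lambda>i. trigamma_gap (a + b) i (1 / rate_param a b t))) \<longlongrightarrow>
        rate_derivative (k - 2) (trigamma_gap_limit a) (trigamma_gap_limit (a + b))) F"
      using ab k by (intro rate_derivative_tendsto filterlim_compose[OF trigamma_gap_tendsto x]) auto
    moreover have "right_rate_chain a b k = (\<lambda>t. rate_derivative (k - 2)
        (\<lambda>i. trigamma_gap a i (1 / rate_param a b t)) (\<lambda>i. trigamma_gap (a + b) i (1 / rate_param a b t)))"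
      using k by (auto simp: right_rate_chain_def Let_def fun_eq_iff)
    ultimately show ?thesis
      using rate_derivative_limit[OF ab k] by simp
  qed
  thus ?thesis by (simp add: F_def)
qed

end

subsection \<open>Analyticity away from the minimum\<close>

lemma real_analytic_on_cong:
  assumes "open S" "\<And>x. x \<in> S \<Longrightarrow> f x = g x" "real_analytic_on g S"
  shows "real_analytic_on f S"
  unfolding real_analytic_on_def
proof
  fix x assume x: "x \<in> S"
  obtain r a where r: "r > 0" "\<And>y. y \<in> ball x r \<Longrightarrow> (\<lambda>n. a n * (y - x) ^ n) sums g y"
    using assms(3) x unfolding real_analytic_on_def by blast
  obtain e where e: "e > 0" "ball x e \<subseteq> S"
    using \<open>open S\<close> x by (meson openE)
  show "\<exists>r>0. \<exists>a. \<forall>y\<in>ball x r. (\<lambda>n. a n * (y - x) ^ n) sums f y"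
  proof (intro exI[of _ "min r e"] exI[of _ a] conjI ballI)
    fix y assume y: "y \<in> ball x (min r e)"
    hence "f y = g y"
      using e(2) by (intro assms(2)) auto
    thus "(\<lambda>n. a n * (y - x) ^ n) sums f y"
      using r(2)[of y] y by simp
  qed (use r e in auto)
qed

lemma real_analytic_on_reflect:
  assumes "real_analytic_on f ((\<lambda>t. c - t) ` S)"
  shows "real_analytic_on (\<lambda>t. f (c - t)) S"
  unfolding real_analytic_on_def
proof
  fix x assume "x \<in> S"
  then obtain r a where r: "r > 0" "\<And>y. y \<in> ball (c - x) r \<Longrightarrow> (\<lambda>n. a n * (y - (c - x)) ^ n) sums f y"
    using assms unfolding real_analytic_on_def by blast
  have "(\<lambda>n. ((-1) ^ n * a n) * (y - x) ^ n) sums f (c - y)" if "y \<in> ball x r" for y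
  proof -
    have "c - y - (c - x) = - 1 * (y - x)" by simp
    hence "(c - y - (c - x)) ^ n = (-1) ^ n * (y - x) ^ n" for n
      by (simp only: power_mult_distrib)
    moreover have "(\<lambda>n. a n * (c - y - (c - x)) ^ n) sums f (c - y)"
      using that by (intro r) (auto simp: dist_real_def)
    ultimately show ?thesis
      by (simp add: mult_ac)
  qed
  thus "\<exists>r>0. \<exists>a. \<forall>y\<in>ball x r. (\<lambda>n. a n * (y - x) ^ n) sums f (c - y)"
    using r(1) by (intro exI[of _ r] exI[of _ "\<lambda>n. (-1) ^ n * a n"] conjI ballI)
qed

lemma Re_mult_of_real: "Re (z * of_real c) = Re z * c"
  by simp

text \<open>The real parts of the complex Taylor coefficients serve as coefficients: at real
  arguments the powers are real, so taking real parts acts on the coefficients alone.\<close>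

lemma real_analytic_on_of_holomorphic:
  assumes "\<And>x. x \<in> S \<Longrightarrow> \<exists>r>0. \<exists>F. F holomorphic_on ball (of_real x) r \<and>
      (\<forall>y\<in>ball x r. F (of_real y) = of_real (f y))"
  shows "real_analytic_on f S"
  unfolding real_analytic_on_def
proof
  fix x assume "x \<in> S"
  then obtain r F where r: "r > 0" "F holomorphic_on ball (of_real x) r"
    and F: "\<And>y. y \<in> ball x r \<Longrightarrow> F (of_real y) = of_real (f y)"
    using assms by blast
  define a where "a = (\<lambda>n. Re ((deriv ^^ n) F (of_real x) / fact n))"
  have "(\<lambda>n. a n * (y - x) ^ n) sums f y" if y: "y \<in> ball x r" for y
  proof -
    have "complex_of_real y \<in> ball (of_real x) r"
      using y by (simp add: dist_of_real)
    from holomorphic_power_series[OF r(2) this]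
    have "(\<lambda>n. (deriv ^^ n) F (of_real x) / fact n * of_real ((y - x) ^ n)) sums of_real (f y)"
      using F[OF y] by simp
    from sums_Re[OF this] show ?thesis
      unfolding a_def Re_mult_of_real Re_complex_of_real .
  qed
  thus "\<exists>r>0. \<exists>a. \<forall>y\<in>ball x r. (\<lambda>n. a n * (y - x) ^ n) sums f y"
    using r(1) by (intro exI[of _ r] exI[of _ a] conjI ballI)
qed

lemma Re_pos_notin_nonpos_Ints: "Re z > 0 \<Longrightarrow> z \<notin> \<int>\<^sub>\<le>\<^sub>0"
  by (auto elim!: nonpos_Ints_cases)

lemma holomorphic_on_Polygamma_compose:
  assumes "g holomorphic_on A" "\<And>z. z \<in> A \<Longrightarrow> Re (g z) > 0"
  shows "(\<lambda>z. Polygamma n (g z)) holomorphic_on A"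
  using holomorphic_on_compose_gen[OF assms(1) holomorphic_on_Polygamma[of "{z. Re z > 0}" n]] assms(2)
    Re_pos_notin_nonpos_Ints by (auto simp: o_def)

text \<open>The ratio extends to a complex map \<open>T\<close> whose derivative at l is the nonzero
  real one. So \<open>T\<close> has a local holomorphic inverse \<open>g\<close>, and inserting
  \<open>g\<close> for the parameter in the closed form gives a holomorphic extension of the
  rate.\<close>

lemma right_rate_analytic:
  assumes ab: "a > 0" "b > 0"
  shows "real_analytic_on (right_rate a b) {a / (a + b)<..<1}"
proof (rule real_analytic_on_of_holomorphic)
  fix t assume t: "t \<in> {a / (a + b)<..<1}"
  define l where "l = rate_param a b t"
  have l: "l > 0" "trigamma_ratio a b l = t"
    unfolding l_def using rate_param[OF ab t] by auto
  define P :: "real \<Rightarrow> complex \<Rightarrow> complex"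
    where "P = (\<lambda>s z. Polygamma 1 z - Polygamma 1 (of_real s + z))"
  define T where "T = (\<lambda>z. P a z / P (a + b) z)"
  define S where "S = {z. Re z > 0} \<inter> P (a + b) -` (- {0})"
  have holP: "P s holomorphic_on {z. Re z > 0}" if "s > 0" for s
    unfolding P_def using that
    by (intro holomorphic_on_diff holomorphic_on_Polygamma_compose holomorphic_intros) auto
  have "open S"
    unfolding S_def using ab
    by (intro continuous_open_preimage holomorphic_on_imp_continuous_on holP open_halfspace_Re_gt) auto
  have holT: "T holomorphic_on S"
    unfolding T_def using ab
    by (intro holomorphic_on_divide holomorphic_on_subset[OF holP]) (auto simp: S_def)
  have P_real: "P s (of_real x) = of_real (Polygamma 1 x - Polygamma 1 (s + x))" if "s > 0" "x > 0" for s x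
    using that by (simp add: P_def Polygamma_of_real flip: of_real_add)
  have T_real: "T (of_real x) = of_real (trigamma_ratio a b x)" if "x > 0" for x
    using that ab by (simp add: T_def P_real trigamma_ratio_def)
  have lS: "complex_of_real l \<in> S"
    using l(1) ab polygamma_gap_pos[of l "a + b"] by (simp add: S_def P_real del: of_real_diff)
  have "(T has_field_derivative of_real (trigamma_ratio_deriv a b l)) (at (of_real l))"
  proof -
    define Q :: "real \<Rightarrow> complex \<Rightarrow> complex"
      where "Q = (\<lambda>s z. Polygamma 2 z - Polygamma 2 (of_real s + z))"
    have Q: "(P s has_field_derivative Q s (of_real l)) (at (of_real l))" if "s > 0" for s
    proof -
      have "complex_of_real l \<notin> \<int>\<^sub>\<le>\<^sub>0" "complex_of_real s + complex_of_real l \<notin> \<int>\<^sub>\<le>\<^sub>0"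
        using that l(1) by (auto intro!: Re_pos_notin_nonpos_Ints)
      thus ?thesis
        unfolding P_def Q_def by (auto intro!: derivative_eq_intros simp: numeral_2_eq_2)
    qed
    have Q_real: "Q s (of_real l) = of_real (Polygamma 2 l - Polygamma 2 (s + l))" if "s > 0" for s
      using that l(1) by (simp add: Q_def Polygamma_of_real flip: of_real_add)
    have "(T has_field_derivative (Q a (of_real l) * P (a + b) (of_real l) - P a (of_real l) * Q (a + b) (of_real l))
        / (P (a + b) (of_real l) * P (a + b) (of_real l))) (at (of_real l))"
      unfolding T_def using lS ab by (intro DERIV_divide Q) (auto simp: S_def)
    thus ?thesis
      using l(1) ab by (simp only: Q_real P_real add_pos_pos trigamma_ratio_deriv_def power2_eq_square
          of_real_divide of_real_mult of_real_diff)
  qed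
  hence "deriv T (of_real l) \<noteq> 0"
    using trigamma_ratio_deriv_neg[OF ab l(1)] by (simp add: DERIV_imp_deriv)
  from has_complex_derivative_locally_invertible[OF holT lS \<open>open S\<close> this]
  obtain r where r: "r > 0" "ball (of_real l) r \<subseteq> S" "open (T ` ball (of_real l) r)"
    "inj_on T (ball (of_real l) r)" .
  obtain g where g: "g holomorphic_on T ` ball (of_real l) r" "\<And>z. z \<in> ball (of_real l) r \<Longrightarrow> g (T z) = z"
    using holomorphic_has_inverse[OF holomorphic_on_subset[OF holT r(2)] open_ball r(4)] by metis
  define F where "F = (\<lambda>w. w * Digamma (of_real (a + b) + g w) + (1 - w) * Digamma (g w) - Digamma (of_real a + g w))"
  have gpos: "Re (g w) > 0" if "w \<in> T ` ball (of_real l) r" for w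
    using that g(2) r(2) by (auto simp: S_def)
  have holF: "F holomorphic_on T ` ball (of_real l) r"
    unfolding F_def
    by (intro holomorphic_on_diff holomorphic_on_add holomorphic_on_mult holomorphic_on_const holomorphic_on_ident
        holomorphic_on_Polygamma_compose g) (use ab gpos in \<open>auto intro!: add_pos_pos\<close>)
  have "of_real t \<in> T ` ball (of_real l) r"
    using imageI[of "of_real l" "ball (of_real l) r" T] T_real[OF l(1)] l(2) r(1) by simp
  then obtain r1 where r1: "r1 > 0" "ball (of_real t) r1 \<subseteq> T ` ball (of_real l) r"
    using r(3) by (meson openE)
  \<comment> \<open>\<open>g\<close> is known to invert \<open>T\<close> only on the ball around l.
    Continuity of \<open>rate_param\<close> puts the real parameter into that ball, so that both
    inverses agree at real y near t.\<close>
  have "\<forall>\<^sub>F y in nhds t. dist (rate_param a b y) l < r"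
    using isCont_rate_param[OF ab t] r(1)
    unfolding isCont_def tendsto_at_iff_tendsto_nhds l_def by (rule tendstoD)
  moreover have "\<forall>\<^sub>F y in nhds t. y \<in> {a / (a + b)<..<1}"
    using t by (intro eventually_nhds_in_open) auto
  ultimately have "\<forall>\<^sub>F y in nhds t. dist (rate_param a b y) l < r \<and> y \<in> {a / (a + b)<..<1}"
    by (rule eventually_conj)
  then obtain r2 where r2: "r2 > 0"
    "\<And>y. dist y t < r2 \<Longrightarrow> dist (rate_param a b y) l < r \<and> y \<in> {a / (a + b)<..<1}"
    unfolding eventually_nhds_metric by blast
  have "F (of_real y) = of_real (right_rate a b y)" if y: "y \<in> ball t r2" for y
  proof -
    define m where "m = rate_param a b y"
    have y': "y \<in> {a / (a + b)<..<1}" and m: "dist m l < r"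
      using r2(2)[of y] y by (auto simp: dist_commute m_def)
    have mpos: "m > 0" "trigamma_ratio a b m = y"
      using rate_param[OF ab y'] by (auto simp: m_def)
    have "g (T (of_real m)) = of_real m"
      using m by (intro g) (simp add: dist_of_real dist_commute)
    hence "g (of_real y) = of_real m"
      using T_real[OF mpos(1)] mpos(2) by simp
    moreover have "Digamma (of_real (s + m)) = complex_of_real (Digamma (s + m))" if "s \<ge> 0" for s
      using mpos(1) that by (intro Polygamma_of_real) auto
    from this[of "a + b"] this[of a] this[of 0]
    have "Digamma (of_real (a + b) + of_real m) = complex_of_real (Digamma (a + b + m))"
      "Digamma (of_real a + of_real m) = complex_of_real (Digamma (a + m))"
      "Digamma (of_real m) = complex_of_real (Digamma m)"
      using ab by auto
    ultimately show ?thesis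
      by (simp add: F_def right_rate_def Let_def m_def[symmetric])
  qed
  moreover have "F holomorphic_on ball (of_real t) (min r1 r2)"
    using r1(2) by (intro holomorphic_on_subset[OF holF]) auto
  ultimately show "\<exists>r>0. \<exists>F. F holomorphic_on ball (of_real t) r \<and>
      (\<forall>y\<in>ball t r. F (of_real y) = of_real (right_rate a b y))"
    using r1(1) r2(1) by (intro exI[of _ "min r1 r2"] conjI exI[of _ F]) auto
qed

subsection \<open>The expansions at the minimum\<close>

text \<open>The matching condition for the two branches: each derivative of the reflection t -> 1 -
  t contributes a sign.\<close>

lemma rate_coeff_swap: "k \<le> 4 \<Longrightarrow> (-1) ^ k * rate_coeff b a k = rate_coeff a b k"
proof -
  assume "k \<le> 4"
  hence "k = 0 \<or> k = 1 \<or> k = 2 \<or> k = 3 \<or> k = 4" by auto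
  thus ?thesis
    by (elim disjE) (simp_all add: rate_coeff_def divide_simps, simp_all add: algebra_simps eval_nat_numeral)
qed

lemma quenched_rate_formula_right:
  "a / (a + b) < t \<Longrightarrow> quenched_rate_formula a b t = right_rate a b t"
  by (simp add: quenched_rate_formula_def right_rate_def)

lemma quenched_rate_formula_left:
  "t < a / (a + b) \<Longrightarrow> quenched_rate_formula a b t = right_rate b a (1 - t)"
  by (simp add: quenched_rate_formula_def right_rate_def Let_def add.commute)

text \<open>Carried to order 5, one further than the quenched chain, because the averaged error is
  of fifth order.\<close>

definition averaged_rate_chain :: "real \<Rightarrow> real \<Rightarrow> nat \<Rightarrow> real \<Rightarrow> real" where
  "averaged_rate_chain a b k t =
     [averaged_rate a b t,
      ln (t / (a / (a + b))) - ln ((1 - t) / (b / (a + b))),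
      1 / t + 1 / (1 - t),
      - 1 / t ^ 2 + 1 / (1 - t) ^ 2,
      2 / t ^ 3 + 2 / (1 - t) ^ 3,
      - 6 / t ^ 4 + 6 / (1 - t) ^ 4] ! k"

text \<open>The middle case prescribes the intended derivatives at the minimum, which makes every
  member of order up to 4 continuous there. That they are derivatives follows afterwards from the
  two sides.\<close>

definition quenched_rate_chain :: "real \<Rightarrow> real \<Rightarrow> nat \<Rightarrow> real \<Rightarrow> real" where
  "quenched_rate_chain a b k t =
     (if a / (a + b) < t then right_rate_chain a b k t
      else if t = a / (a + b) then rate_coeff a b k
      else (-1) ^ k * right_rate_chain b a k (1 - t))"

context
  fixes a b :: real
  assumes ab: "a > 0" "b > 0"
begin

lemma averaged_rate_chain_DERIV:
  assumes t: "t \<in> {0<..<1}" and "k < 5"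
  shows "(averaged_rate_chain a b k has_real_derivative averaged_rate_chain a b (Suc k) t) (at t)"
proof -
  have pos: "t > 0" "1 - t > 0" "t < 1" using t by auto
  define p q where pq: "p = a / (a + b)" "q = b / (a + b)"
  have pq_pos: "p > 0" "q > 0" using ab by (simp_all add: pq)
  have "k = 0 \<or> k = 1 \<or> k = 2 \<or> k = 3 \<or> k = 4" using \<open>k < 5\<close> by auto
  thus ?thesis
  proof (elim disjE)
    assume k: "k = 0"
    show ?thesis
      unfolding k averaged_rate_chain_def averaged_rate_def pq[symmetric] using pos pq_pos
      by (auto intro!: derivative_eq_intros simp: divide_simps)
  next
    assume k: "k = 1"
    show ?thesis
      unfolding k averaged_rate_chain_def pq[symmetric] using pos pq_pos
      by (auto intro!: derivative_eq_intros simp: divide_simps)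
  next
    assume k: "k = 2"
    show ?thesis
      unfolding k averaged_rate_chain_def using pos
      by (auto intro!: derivative_eq_intros) (simp add: divide_simps, simp add: algebra_simps eval_nat_numeral)
  next
    assume k: "k = 3"
    show ?thesis
      unfolding k averaged_rate_chain_def using pos
      by (auto intro!: derivative_eq_intros) (simp add: divide_simps, simp add: algebra_simps eval_nat_numeral)
  next
    assume k: "k = 4"
    show ?thesis
      unfolding k averaged_rate_chain_def using pos
      by (auto intro!: derivative_eq_intros) (simp add: divide_simps, simp add: algebra_simps eval_nat_numeral)
  qed
qed

lemma averaged_rate_chain_at_min:
  "k \<le> 3 \<Longrightarrow> averaged_rate_chain a b k (a / (a + b)) = rate_coeff a b k"
  "averaged_rate_chain a b 4 (a / (a + b)) = 2 * (a + b)^3 * (a^3 + b^3) / (a^3 * b^3)"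
proof -
  have pos: "a \<noteq> 0" "b \<noteq> 0" "a + b \<noteq> 0" using ab by auto
  have c': "1 - a / (a + b) = b / (a + b)"
    using pos by (simp add: field_simps)
  show "averaged_rate_chain a b k (a / (a + b)) = rate_coeff a b k" if "k \<le> 3"
  proof -
    have "k = 0 \<or> k = 1 \<or> k = 2 \<or> k = 3" using that by auto
    thus ?thesis
      using pos by (elim disjE) (simp_all add: averaged_rate_chain_def averaged_rate_def rate_coeff_def c'
          divide_simps, simp_all add: algebra_simps eval_nat_numeral)
  qed
  show "averaged_rate_chain a b 4 (a / (a + b)) = 2 * (a + b)^3 * (a^3 + b^3) / (a^3 * b^3)"
    using pos by (simp add: averaged_rate_chain_def c' power_divide field_simps)
qed

lemma isCont_averaged_rate_chain:
  assumes "t \<in> {0<..<1}" "k \<le> 5"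
  shows "isCont (averaged_rate_chain a b k) t"
proof (cases "k < 5")
  case True
  thus ?thesis using averaged_rate_chain_DERIV[OF assms(1)] by (blast intro: DERIV_isCont)
next
  case False
  hence k: "k = 5" using assms by simp
  show ?thesis
    unfolding averaged_rate_chain_def k using assms by (auto intro!: continuous_intros)
qed

lemma quenched_rate_chain_0:
  "quenched_rate_chain a b 0 t = quenched_rate_formula a b t"
proof (cases "a / (a + b)" t rule: linorder_cases)
  case equal
  thus ?thesis
    by (auto simp: quenched_rate_chain_def quenched_rate_formula_def rate_coeff_def)
qed (simp_all add: quenched_rate_chain_def right_rate_chain_def quenched_rate_formula_right
    quenched_rate_formula_left)

lemma isCont_quenched_rate_chain_min:
  assumes "k \<le> 4"
  shows "isCont (quenched_rate_chain a b k) (a / (a + b))"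
proof -
  define c where "c = a / (a + b)"
  have c': "1 - c = b / (b + a)"
    using ab by (simp add: c_def field_simps)
  have "(right_rate_chain a b k \<longlongrightarrow> rate_coeff a b k) (at_right c)"
    unfolding c_def using right_rate_chain_tendsto[OF ab assms] .
  moreover have "\<forall>\<^sub>F t in at_right c. right_rate_chain a b k t = quenched_rate_chain a b k t"
    using eventually_at_right_less[of c] by eventually_elim (simp add: quenched_rate_chain_def c_def)
  ultimately have right: "(quenched_rate_chain a b k \<longlongrightarrow> rate_coeff a b k) (at_right c)"
    by (rule Lim_transform_eventually)
  have "filterlim (\<lambda>t. 1 - t) (at_right (1 - c)) (at_left c)"
    unfolding filterlim_at
    by (auto intro!: tendsto_eq_intros eventually_at_leftI[of "c - 1"])
  hence "((\<lambda>t. (-1) ^ k * right_rate_chain b a k (1 - t)) \<longlongrightarrow> (-1) ^ k * rate_coeff b a k) (at_left c)"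
    unfolding c' by (intro tendsto_intros filterlim_compose[OF right_rate_chain_tendsto[OF ab(2,1) assms]])
  moreover have "\<forall>\<^sub>F t in at_left c. (-1) ^ k * right_rate_chain b a k (1 - t) = quenched_rate_chain a b k t"
    using eventually_at_left_real[of "c - 1" c]
    by (auto elim!: eventually_mono simp: quenched_rate_chain_def c_def)
  ultimately have "(quenched_rate_chain a b k \<longlongrightarrow> rate_coeff a b k) (at_left c)"
    unfolding rate_coeff_swap[OF assms] by (rule Lim_transform_eventually)
  from filterlim_split_at[OF this right] show ?thesis
    by (simp add: isCont_def c_def quenched_rate_chain_def)
qed

lemma quenched_rate_chain_DERIV:
  assumes t: "t \<in> {0<..<1}" and "k < 4"
  shows "(quenched_rate_chain a b k has_real_derivative quenched_rate_chain a b (Suc k) t) (at t)"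
proof -
  define c where "c = a / (a + b)"
  have c': "1 - c = b / (b + a)"
    using ab by (simp add: c_def field_simps)
  have c: "0 < c" "c < 1"
    using ab by (auto simp: c_def)
  have right: "(quenched_rate_chain a b k has_real_derivative quenched_rate_chain a b (Suc k) t) (at t)"
    if t: "t \<in> {c<..<1}" for t
  proof (rule has_field_derivative_transform_within_open[where S = "{c<..<1}"])
    show "(right_rate_chain a b k has_real_derivative quenched_rate_chain a b (Suc k) t) (at t)"
      using right_rate_chain_DERIV[OF ab, of t k] t \<open>k < 4\<close> by (simp add: quenched_rate_chain_def c_def)
  qed (use t in \<open>auto simp: quenched_rate_chain_def c_def\<close>)
  have left: "(quenched_rate_chain a b k has_real_derivative quenched_rate_chain a b (Suc k) t) (at t)"
    if t: "t \<in> {0<..<c}" for t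
  proof (rule has_field_derivative_transform_within_open[where S = "{0<..<c}"])
    have "1 - t \<in> {b / (b + a)<..<1}"
      using t by (simp flip: c')
    from right_rate_chain_DERIV[OF ab(2,1) this \<open>k < 4\<close>]
    have "((\<lambda>t. right_rate_chain b a k (1 - t)) has_real_derivative
        right_rate_chain b a (Suc k) (1 - t) * (0 - 1)) (at t)"
      by (rule DERIV_chain2) (intro derivative_intros)
    \<comment> \<open>The inner derivative -1 raises the sign to
      \<open>(-1) ^ Suc k\<close>.\<close>
    from DERIV_cmult[OF this, of "(-1) ^ k"]
    show "((\<lambda>t. (-1) ^ k * right_rate_chain b a k (1 - t)) has_real_derivative
        quenched_rate_chain a b (Suc k) t) (at t)"
      using t by (simp add: quenched_rate_chain_def c_def)
  qed (use t in \<open>auto simp: quenched_rate_chain_def c_def\<close>)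
  \<comment> \<open>At the junction the members k and k + 1 are both continuous, as k + 1 is at most
    4, and the derivative is known on either side.\<close>
  have "(quenched_rate_chain a b k has_real_derivative quenched_rate_chain a b (Suc k) c) (at c)"
  proof (rule DERIV_limit_of_derivative)
    show "\<forall>\<^sub>F x in at c. (quenched_rate_chain a b k has_real_derivative quenched_rate_chain a b (Suc k) x) (at x)"
      unfolding eventually_at_filter
    proof (rule eventually_mono)
      show "\<forall>\<^sub>F x in nhds c. x \<in> {0<..<1}"
        using c by (intro eventually_nhds_in_open) auto
    qed (use left right in \<open>auto simp: neq_iff\<close>)
  qed (use isCont_quenched_rate_chain_min[of k] isCont_quenched_rate_chain_min[of "Suc k"] \<open>k < 4\<close>
      in \<open>auto simp: c_def\<close>)
  thus ?thesis
    using left[of t] right[of t] t by (cases t c rule: linorder_cases) auto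
qed

lemma continuous_on_quenched_rate_chain_4: "continuous_on {0<..<1} (quenched_rate_chain a b 4)"
proof -
  define c where "c = a / (a + b)"
  have c': "1 - c = b / (b + a)"
    using ab by (simp add: c_def field_simps)
  have "isCont (quenched_rate_chain a b 4) t" if t: "t \<in> {0<..<1}" for t
  proof (cases c t rule: linorder_cases)
    case equal
    thus ?thesis using isCont_quenched_rate_chain_min[of 4] by (simp add: c_def)
  next
    case less
    have "isCont (right_rate_chain a b 4) t"
      using less t by (intro isCont_right_rate_chain[OF ab]) (auto simp: c_def)
    moreover have "\<forall>\<^sub>F x in nhds t. x \<in> {c<..}"
      using less by (intro eventually_nhds_in_open) auto
    hence "\<forall>\<^sub>F x in nhds t. quenched_rate_chain a b 4 x = right_rate_chain a b 4 x"
      by eventually_elim (auto simp: quenched_rate_chain_def c_def)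
    ultimately show ?thesis
      by (simp add: isCont_cong)
  next
    case greater
    have "isCont (right_rate_chain b a 4) (1 - t)"
      using greater t by (intro isCont_right_rate_chain[OF ab(2,1)]) (auto simp flip: c')
    hence "isCont (\<lambda>t. right_rate_chain b a 4 (1 - t)) t"
      by (rule isCont_o2[where f = "\<lambda>t. 1 - t", rotated]) simp
    moreover have "\<forall>\<^sub>F x in nhds t. x \<in> {..<c}"
      using greater by (intro eventually_nhds_in_open) auto
    hence "\<forall>\<^sub>F x in nhds t. quenched_rate_chain a b 4 x = right_rate_chain b a 4 (1 - x)"
      by eventually_elim (auto simp: quenched_rate_chain_def c_def)
    ultimately show ?thesis
      by (simp add: isCont_cong)
  qed
  thus ?thesis
    by (intro continuous_at_imp_continuous_on) auto
qed

end

theorem mainTheorem7: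
  fixes \<alpha> \<beta> :: real
    and M :: "'s measure"
    and \<omega> :: "int \<times> int \<Rightarrow> 's \<Rightarrow> real"
    and br :: "nat \<Rightarrow> real \<Rightarrow> int \<times> int"
    and I\<^sub>q :: "real \<Rightarrow> real"
    and c :: real
  assumes "\<alpha> > 0" and "\<beta> > 0"
    and environment: "beta_environment M \<alpha> \<beta> \<omega>"
    and br: "\<And>N t. t \<in> {0..1} \<Longrightarrow> closest_lattice_point N t (br N t)"
    and quenched: "quenched_rate_function M \<omega> br I\<^sub>q"
    and quenched_explicit: "\<And>t. t \<in> {0<..<1} \<Longrightarrow> I\<^sub>q t = quenched_rate_formula \<alpha> \<beta> t"
    and c: "c = \<alpha> / (\<alpha> + \<beta>)"
  shows "real_analytic_on I\<^sub>q {0<..<c} \<and> real_analytic_on I\<^sub>q {c<..<1} \<and>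
    times_cont_differentiable_at 4 I\<^sub>q c \<and>
    (\<lambda>t. I\<^sub>q t -
       ((\<alpha> + \<beta>)^2 / (2 * \<alpha> * \<beta>) * (t - c)^2
        + (\<alpha> + \<beta>)^3 * (\<alpha> - \<beta>) / (6 * \<alpha>^2 * \<beta>^2) * (t - c)^3
        + (\<alpha> + \<beta>)^4 * (2 * \<alpha>^2 - 2 * \<alpha> * \<beta> + 2 * \<beta>^2 + 1) / (24 * \<alpha>^3 * \<beta>^3) * (t - c)^4))
      \<in> o[at c](\<lambda>t. \<bar>t - c\<bar>^4) \<and>
    (\<lambda>t. averaged_rate \<alpha> \<beta> t -
       ((\<alpha> + \<beta>)^2 / (2 * \<alpha> * \<beta>) * (t - c)^2
        + (\<alpha> + \<beta>)^3 * (\<alpha> - \<beta>) / (6 * \<alpha>^2 * \<beta>^2) * (t - c)^3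
        + (\<alpha> + \<beta>)^3 * (\<alpha>^3 + \<beta>^3) / (12 * \<alpha>^3 * \<beta>^3) * (t - c)^4))
      \<in> O[at c](\<lambda>t. \<bar>t - c\<bar>^5) \<and>
    (\<forall>k\<le>3. (deriv ^^ k) I\<^sub>q c = (deriv ^^ k) (averaged_rate \<alpha> \<beta>) c) \<and>
    times_cont_differentiable_at 4 (\<lambda>t. I\<^sub>q t - averaged_rate \<alpha> \<beta> t) c \<and>
    (deriv ^^ 4) (\<lambda>t. I\<^sub>q t - averaged_rate \<alpha> \<beta> t) c = (\<alpha> + \<beta>)^4 / (\<alpha>^3 * \<beta>^3) \<and>
    (\<alpha> + \<beta>)^4 / (\<alpha>^3 * \<beta>^3) > 0"
proof (intro conjI)
  have ab: "\<alpha> > 0" "\<beta> > 0" by fact+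
  have atMost4: "{..4::nat} = {0, 1, 2, 3, 4}" and atMost5: "{..5::nat} = {0, 1, 2, 3, 4, 5}"
    by auto
  have c01: "0 < c" "c < 1" using ab by (auto simp: c)
  have c': "1 - c = \<beta> / (\<beta> + \<alpha>)"
    using ab by (simp add: c field_simps)
  define e where "e = min c (1 - c)"
  have e: "e > 0" using c01 by (simp add: e_def)
  have ball: "ball c e \<subseteq> {0<..<1}"
    by (auto simp: e_def dist_real_def abs_if split: if_splits)
  define H where "H = quenched_rate_chain \<alpha> \<beta>"
  define A where "A = averaged_rate_chain \<alpha> \<beta>"
  have Hc: "H k c = rate_coeff \<alpha> \<beta> k" for k
    by (simp add: H_def quenched_rate_chain_def c)
  have A0: "averaged_rate \<alpha> \<beta> t = A 0 t" for t
    by (simp add: A_def averaged_rate_chain_def)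
  have H0: "I\<^sub>q t = H 0 t" if "t \<in> ball c e" for t
    using that ball quenched_explicit[of t] by (auto simp: H_def quenched_rate_chain_0[OF ab])
  have H: "(H k has_real_derivative H (Suc k) t) (at t)" if "k < 4" "t \<in> ball c e" for k t
    unfolding H_def using that ball by (intro quenched_rate_chain_DERIV[OF ab]) auto
  have A: "(A k has_real_derivative A (Suc k) t) (at t)" if "k < 5" "t \<in> ball c e" for k t
    unfolding A_def using that ball by (intro averaged_rate_chain_DERIV[OF ab]) auto
  have H4: "continuous_on (ball c e) (H 4)"
    unfolding H_def using continuous_on_quenched_rate_chain_4[OF ab] ball by (rule continuous_on_subset)
  have A4: "continuous_on (ball c e) (A 4)"
    unfolding A_def using isCont_averaged_rate_chain[OF ab, of _ 4] ball
    by (intro continuous_at_imp_continuous_on) auto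
  have Ac: "A k c = rate_coeff \<alpha> \<beta> k" if "k \<le> 3" for k
    unfolding A_def c using averaged_rate_chain_at_min(1)[OF ab that] .
  have A4c: "A 4 c = 2 * (\<alpha> + \<beta>)^3 * (\<alpha>^3 + \<beta>^3) / (\<alpha>^3 * \<beta>^3)"
    unfolding A_def c using averaged_rate_chain_at_min(2)[OF ab] .
  have cb: "c \<in> ball c e" using e by simp
  define J where "J = (\<lambda>k t. H k t - A k t)"
  have J0: "I\<^sub>q t - averaged_rate \<alpha> \<beta> t = J 0 t" if "t \<in> ball c e" for t
    using H0[OF that] by (simp add: J_def A0)
  have J: "(J k has_real_derivative J (Suc k) t) (at t)" if "k < 4" "t \<in> ball c e" for k t
    unfolding J_def using that by (intro DERIV_diff H A) auto
  show "real_analytic_on I\<^sub>q {c<..<1}"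
  proof (rule real_analytic_on_cong)
    show "real_analytic_on (right_rate \<alpha> \<beta>) {c<..<1}"
      unfolding c by (rule right_rate_analytic[OF ab])
    show "I\<^sub>q t = right_rate \<alpha> \<beta> t" if "t \<in> {c<..<1}" for t
      using that c01 quenched_explicit[of t] by (simp add: quenched_rate_formula_right c)
  qed auto
  show "real_analytic_on I\<^sub>q {0<..<c}"
  proof (rule real_analytic_on_cong)
    have "(\<lambda>t. 1 - t) ` {0<..<c} = {1 - c<..<1}"
      by (auto intro!: image_eqI[of _ _ "1 - _"])
    thus "real_analytic_on (\<lambda>t. right_rate \<beta> \<alpha> (1 - t)) {0<..<c}"
      using right_rate_analytic[OF ab(2,1)] by (intro real_analytic_on_reflect) (simp add: c')
    show "I\<^sub>q t = right_rate \<beta> \<alpha> (1 - t)" if "t \<in> {0<..<c}" for t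
      using that c01 quenched_explicit[of t] by (simp add: quenched_rate_formula_left c)
  qed auto
  show "times_cont_differentiable_at 4 I\<^sub>q c"
    by (rule times_cont_differentiable_at_of_chain[OF e H0 H H4])
  show "times_cont_differentiable_at 4 (\<lambda>t. I\<^sub>q t - averaged_rate \<alpha> \<beta> t) c"
    by (rule times_cont_differentiable_at_of_chain[OF e J0 J])
      (auto simp: J_def intro!: continuous_on_diff H4 A4)
  show "\<forall>k\<le>3. (deriv ^^ k) I\<^sub>q c = (deriv ^^ k) (averaged_rate \<alpha> \<beta>) c"
    using higher_deriv_of_chain[where H = H and n = 4, OF open_ball H0 H _ cb]
      higher_deriv_of_chain[where H = A and n = 5, OF open_ball A0 A _ cb] by (simp add: Hc Ac)
  have "(deriv ^^ 4) (\<lambda>t. I\<^sub>q t - averaged_rate \<alpha> \<beta> t) c = J 4 c"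
    using higher_deriv_of_chain[where H = J and n = 4, OF open_ball J0 J _ cb] by simp
  \<comment> \<open>Since a^3 + b^3 = (a + b)(a^2 - a b + b^2), the averaged value cancels
    everything in the quenched one but the summand 1.\<close>
  also have "\<dots> = (\<alpha> + \<beta>)^4 / (\<alpha>^3 * \<beta>^3)"
    using ab by (simp add: J_def Hc A4c rate_coeff_def flip: diff_divide_distrib)
      (simp add: algebra_simps eval_nat_numeral)
  finally show "(deriv ^^ 4) (\<lambda>t. I\<^sub>q t - averaged_rate \<alpha> \<beta> t) c = (\<alpha> + \<beta>)^4 / (\<alpha>^3 * \<beta>^3)" .
  show "(\<alpha> + \<beta>)^4 / (\<alpha>^3 * \<beta>^3) > 0"
    using ab by simp
  have "isCont (H 4) c"
    using isCont_quenched_rate_chain_min[OF ab, of 4] by (simp add: H_def c)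
  from Taylor_peano[where n = 4, OF e _ H0 H this]
  have "(\<lambda>t. I\<^sub>q t - (\<Sum>m\<le>4. H m c / fact m * (t - c) ^ m)) \<in> o[at c](\<lambda>t. \<bar>t - c\<bar>^4)"
    by simp
  also have "(\<lambda>t. I\<^sub>q t - (\<Sum>m\<le>4. H m c / fact m * (t - c) ^ m)) = (\<lambda>t. I\<^sub>q t -
       ((\<alpha> + \<beta>)^2 / (2 * \<alpha> * \<beta>) * (t - c)^2
        + (\<alpha> + \<beta>)^3 * (\<alpha> - \<beta>) / (6 * \<alpha>^2 * \<beta>^2) * (t - c)^3
        + (\<alpha> + \<beta>)^4 * (2 * \<alpha>^2 - 2 * \<alpha> * \<beta> + 2 * \<beta>^2 + 1) / (24 * \<alpha>^3 * \<beta>^3) * (t - c)^4))"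
    unfolding atMost4 by (simp add: Hc rate_coeff_def fact_numeral mult_ac add_ac)
  finally show "(\<lambda>t. I\<^sub>q t -
       ((\<alpha> + \<beta>)^2 / (2 * \<alpha> * \<beta>) * (t - c)^2
        + (\<alpha> + \<beta>)^3 * (\<alpha> - \<beta>) / (6 * \<alpha>^2 * \<beta>^2) * (t - c)^3
        + (\<alpha> + \<beta>)^4 * (2 * \<alpha>^2 - 2 * \<alpha> * \<beta> + 2 * \<beta>^2 + 1) / (24 * \<alpha>^3 * \<beta>^3) * (t - c)^4))
      \<in> o[at c](\<lambda>t. \<bar>t - c\<bar>^4)"
    .
  have "isCont (A 5) c"
    using isCont_averaged_rate_chain[OF ab, of c 5] c01 by (simp add: A_def)
  from Taylor_peano[where n = 5, OF e _ A0 A this]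
  have "(\<lambda>t. averaged_rate \<alpha> \<beta> t - (\<Sum>m\<le>5. A m c / fact m * (t - c) ^ m)) \<in> o[at c](\<lambda>t. \<bar>t - c\<bar>^5)"
    by simp
  hence "(\<lambda>t. averaged_rate \<alpha> \<beta> t - (\<Sum>m\<le>5. A m c / fact m * (t - c) ^ m)) \<in> O[at c](\<lambda>t. \<bar>t - c\<bar>^5)"
    by (rule landau_o.small_imp_big)
  \<comment> \<open>The expansion of order 5 has error o of the fifth power. Moving its last term
    (120 = 5!) into the error gives the O bound.\<close>
  moreover have "(\<lambda>t. A 5 c / 120 * (t - c) ^ 5) \<in> O[at c](\<lambda>t. \<bar>t - c\<bar>^5)"
    by (rule landau_o.bigI[of "\<bar>A 5 c / 120\<bar> + 1"]) (auto simp: abs_mult power_abs algebra_simps)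
  ultimately have "(\<lambda>t. averaged_rate \<alpha> \<beta> t - (\<Sum>m\<le>5. A m c / fact m * (t - c) ^ m) + A 5 c / 120 * (t - c) ^ 5)
      \<in> O[at c](\<lambda>t. \<bar>t - c\<bar>^5)"
    by (rule sum_in_bigo)
  also have "(\<lambda>t. averaged_rate \<alpha> \<beta> t - (\<Sum>m\<le>5. A m c / fact m * (t - c) ^ m) + A 5 c / 120 * (t - c) ^ 5) =
    (\<lambda>t. averaged_rate \<alpha> \<beta> t -
       ((\<alpha> + \<beta>)^2 / (2 * \<alpha> * \<beta>) * (t - c)^2
        + (\<alpha> + \<beta>)^3 * (\<alpha> - \<beta>) / (6 * \<alpha>^2 * \<beta>^2) * (t - c)^3
        + (\<alpha> + \<beta>)^3 * (\<alpha>^3 + \<beta>^3) / (12 * \<alpha>^3 * \<beta>^3) * (t - c)^4))"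
    unfolding atMost5 by (simp add: Ac A4c rate_coeff_def fact_numeral mult_ac) (simp add: fun_eq_iff)
  finally show "(\<lambda>t. averaged_rate \<alpha> \<beta> t -
       ((\<alpha> + \<beta>)^2 / (2 * \<alpha> * \<beta>) * (t - c)^2
        + (\<alpha> + \<beta>)^3 * (\<alpha> - \<beta>) / (6 * \<alpha>^2 * \<beta>^2) * (t - c)^3
        + (\<alpha> + \<beta>)^3 * (\<alpha>^3 + \<beta>^3) / (12 * \<alpha>^3 * \<beta>^3) * (t - c)^4))
      \<in> O[at c](\<lambda>t. \<bar>t - c\<bar>^5)" .
qed

end
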